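(* Let $1\le m\le n$ be integers and $p\in[0,1]$. Let $\alpha=(a_1,\ldots,a_m)\in[n]^m$ be a preference list chosen uniformly at random, and let the $m$ cars park on $n$ spots under the probabilistic parking protocol with parameter $p$. Then $$\mathbb{E}(a_m\mid\alpha\in\mathrm{PF}_{m,n})=\frac{n+2p}{2}-\left(p-\frac12\right)\frac{e^{n+1}(m-1)!\,\mathbb{P}(Z\le m-1)}{(n+1)^{m-1}},$$ where $Z$ is a Poisson random variable with parameter $\lambda=n+1$. Equivalently, $$\mathbb{E}(a_m\mid\alpha\in\mathrm{PF}_{m,n})=\frac{n+2p}{2}-\left(p-\frac12\right)\frac{e^{n+1}\,\Gamma(m,n+1)}{(n+1)^{m-1}},$$ where $\Gamma(s,x)=\int_x^\infty t^{s-1}e^{-t}\,dt$ is the upper incomplete gamma function.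
   Context: $[n]=\{1,\ldots,n\}$. Probabilistic parking protocol with parameter $p\in[0,1]$: there are $m$ cars and a one-way street with $n\ge m$ spots numbered $1,\ldots,n$. Cars $1,\ldots,m$ arrive in order; car $i$ has preference $a_i\in[n]$ and first goes to spot $a_i$. If spot $a_i$ is unoccupied, the car parks there. If it is occupied, the driver tosses (once) a biased coin, independent of everything else: with probability $p$ the car moves forward and parks in the first unoccupied spot with number greater than $a_i$, if one exists; with probability $1-p$ the car moves backward and parks in the first unoccupied spot encountered (the largest unoccupied number less than $a_i$), if one exists. If there is no unoccupied spot in the chosen direction, the car fails to park. "$\alpha\in\mathrm{PF}_{m,n}$" denotes the event that all $m$ cars with preference list $\alpha$ succeed in parking; probabilities and expectations are over both the uniform choice of $\alpha\in[n]^m$ and the coin tosses. *)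

theory Defs
  imports "HOL-Probability.Probability"
begin

definition forward_spot :: "nat \<Rightarrow> nat set \<Rightarrow> nat \<Rightarrow> nat option" where
  "forward_spot n A a =
     (if {a<..n} - A = {} then None else Some (Min ({a<..n} - A)))"

definition backward_spot :: "nat set \<Rightarrow> nat \<Rightarrow> nat option" where
  "backward_spot A a =
     (if {1..<a} - A = {} then None else Some (Max ({1..<a} - A)))"

(* The random spot taken by a car with preference a when the set of occupied spots
   is A; the outcome None means that the car fails to park. *)
definition park_car :: "real \<Rightarrow> nat \<Rightarrow> nat set \<Rightarrow> nat \<Rightarrow> nat option pmf" where
  "park_car p n A a =
     (if a \<notin> A then return_pmf (Some a)
      else map_pmf (\<lambda>fwd. if fwd then forward_spot n A a else backward_spot A a)
             (bernoulli_pmf p))"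

fun park_cars :: "real \<Rightarrow> nat \<Rightarrow> nat set \<Rightarrow> nat list \<Rightarrow> nat option list pmf" where
  "park_cars p n A [] = return_pmf []"
| "park_cars p n A (a # as) =
     bind_pmf (park_car p n A a) (\<lambda>s.
       map_pmf (\<lambda>ss. s # ss) (park_cars p n (A \<union> set_option s) as))"

definition preference_lists :: "nat \<Rightarrow> nat \<Rightarrow> nat list set" where
  "preference_lists m n = {\<alpha>. length \<alpha> = m \<and> set \<alpha> \<subseteq> {1..n}}"

definition parking_pmf :: "real \<Rightarrow> nat \<Rightarrow> nat \<Rightarrow> (nat list \<times> nat option list) pmf" where
  "parking_pmf p m n =
     bind_pmf (pmf_of_set (preference_lists m n)) (\<lambda>\<alpha>.
       map_pmf (\<lambda>ss. (\<alpha>, ss)) (park_cars p n {} \<alpha>))"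

definition all_parked :: "(nat list \<times> nat option list) set" where
  "all_parked = {(\<alpha>, ss). None \<notin> set ss}"

definition upper_Gamma :: "real \<Rightarrow> real \<Rightarrow> real" where
  "upper_Gamma s x = (LBINT t:{x..}. t powr (s - 1) * exp (- t))"

lemma finite_preference_lists: "finite (preference_lists m n)"
  using finite_lists_length_eq[of "{1..n}" m]
  by (auto simp: preference_lists_def conj_commute)

lemma park_cars_distinct:
  assumes "distinct \<alpha>" "set \<alpha> \<inter> A = {}"
  shows "park_cars p n A \<alpha> = return_pmf (map Some \<alpha>)"
  using assms
  by (induction \<alpha> arbitrary: A) (auto simp: park_car_def bind_return_pmf)

(* The conditioning event has positive probability, so that conditioning on it with
   cond_pmf is meaningful. *)
lemma all_parked_possible:
  assumes "m \<le> n"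
  shows "set_pmf (parking_pmf p m n) \<inter> all_parked \<noteq> {}"
proof -
  have "[1..<Suc m] \<in> preference_lists m n"
    using assms by (auto simp: preference_lists_def)
  moreover from this have "set_pmf (pmf_of_set (preference_lists m n)) = preference_lists m n"
    by (intro set_pmf_of_set finite_preference_lists) auto
  moreover have "park_cars p n {} [1..<Suc m] = return_pmf (map Some [1..<Suc m])"
    by (intro park_cars_distinct) auto
  ultimately have "([1..<Suc m], map Some [1..<Suc m]) \<in> set_pmf (parking_pmf p m n)"
    unfolding parking_pmf_def set_bind_pmf by (intro UN_I[of "[1..<Suc m]"]) (auto simp del: upt_Suc)
  then show ?thesis
    by (auto simp: all_parked_def simp del: upt_Suc)
qed

end

theory Submission
  imports Defs
begin

text \<open>
Write \<open>M = m - 1\<close>. For a set \<open>S\<close> of \<open>M\<close> spots let \<open>w(S)\<close> be the number of preference lists of the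
first \<open>M\<close> cars, each counted with the probability that these cars all park and together occupy
exactly \<open>S\<close>. Given \<open>S\<close>, a last car with preference \<open>b\<close> fails to park in two situations only: it
moves forward and \<open>{b..n}\<close> is full, or it moves backward and \<open>{1..b}\<close> is full. So if \<open>S\<close> ends in a
full block of length \<open>r\<close> (its tail) and begins with a full block of length \<open>l\<close> (its head), then the
sum of \<open>b\<close> times the probability of parking, over all \<open>b\<close>, is
\<open>n (n + 1) / 2 - p (r (n + 1) - r (r + 1) / 2) - (1 - p) l (l + 1) / 2\<close>, and without the factor \<open>b\<close>
it is \<open>n - p r - (1 - p) l\<close>. The conditional expectation is the quotient of the averages of these two
expressions with respect to \<open>w\<close>.

The weights do not depend on \<open>p\<close>. Removing the car that parked last, at \<open>s\<close> say, gives a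
recursion whose factor is one plus \<open>p\<close> times the length of the run of \<open>S\<close> just left of \<open>s\<close> plus
\<open>1 - p\<close> times that of the run just right of \<open>s\<close> (\<open>sum_park_step\<close>). It follows that \<open>w\<close> is
multiplicative over gaps up to a binomial coefficient (\<open>park_weight_split\<close>); and for a full interval
the pairing of each spot with its mirror image replaces \<open>p\<close> by \<open>1 / 2\<close>, so that an interval of
\<open>k\<close> spots has the weight \<open>(k + 1) ^ (k - 1)\<close> of the classical parking functions
(\<open>park_weight_interval\<close>). Consequently \<open>r\<close> and \<open>l\<close> have the same distribution, and every sum above
becomes a sum over the block length \<open>k\<close> alone.

These are sums of Abel's type. Expanding \<open>(n - k) ^ (M - k)\<close> in powers of \<open>n + 1\<close> and \<open>k + 1\<close> turns
the inner sums into finite differences of powers, which vanish or are multiples of factorials. The total weight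
and the mean block length come out in closed form. The quadratic term \<open>k (k + 1) / 2\<close>, which enters
with the coefficient \<open>p\<close> from the tail and \<open>- (1 - p)\<close> from the head, hence with \<open>2 p - 1\<close>
altogether, produces the truncated exponential sum (\<open>sum_run_triangle\<close>) that is a Poisson
probability, or equivalently an incomplete gamma value.
\<close>

section \<open>Sums of Abel's type\<close>

text \<open>
The \<open>n\<close>-th finite difference of \<open>t \<mapsto> t ^ j\<close> at \<open>x\<close>.
\<close>

definition alt_sum :: "nat \<Rightarrow> nat \<Rightarrow> real \<Rightarrow> real" where
  "alt_sum n j x = (\<Sum>k\<le>n. real (n choose k) * (-1) ^ (n - k) * (x + real k) ^ j)"

lemma alt_sum_0: "alt_sum n 0 x = (if n = 0 then 1 else 0)"
proof -
  have "alt_sum n 0 x = (1 + (-1)) ^ n"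
    unfolding alt_sum_def binomial_ring by simp
  then show ?thesis by simp
qed

text \<open>
Absorption, \<open>k (n choose k) = n ((n - 1) choose (k - 1))\<close>, applied under the sum. For \<open>n = 0\<close> the
truncated \<open>n - 1\<close> is harmless because of the factor \<open>n\<close>.
\<close>

lemma weighted_binomial_shift:
  "(\<Sum>k\<le>n. real (n choose k) * real k * f k)
    = real n * (\<Sum>k\<le>n - 1. real ((n - 1) choose k) * f (Suc k))"
proof (cases n)
  case (Suc m)
  have "(\<Sum>k\<le>n. real (n choose k) * real k * f k)
      = (\<Sum>k\<le>m. real (Suc m choose Suc k) * real (Suc k) * f (Suc k))"
    unfolding Suc by (subst sum.atMost_Suc_shift) simp
  also have "\<dots> = (\<Sum>k\<le>m. real (Suc m) * (real (m choose k) * f (Suc k)))"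
  proof (rule sum.cong[OF refl])
    fix k
    have "real (Suc m choose Suc k) * real (Suc k) = real (Suc m) * real (m choose k)"
      using Suc_times_binomial_eq[of m k] by (metis of_nat_mult)
    then show "real (Suc m choose Suc k) * real (Suc k) * f (Suc k)
        = real (Suc m) * (real (m choose k) * f (Suc k))"
      by (simp only: mult.assoc[symmetric])
  qed
  finally show ?thesis using Suc by (simp add: sum_distrib_left)
qed simp

text \<open>
Splitting one factor \<open>x + k\<close> off the power: \<open>x\<close> is constant, and \<open>k\<close> is absorbed into the binomial
coefficient. Every value of \<^const>\<open>alt_sum\<close> that is needed follows by induction from this recursion.
\<close>

lemma alt_sum_Suc:
  "alt_sum n (Suc j) x = x * alt_sum n j x + real n * alt_sum (n - 1) j (x + 1)"
proof -
  have "alt_sum n (Suc j) x = x * alt_sum n j x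
      + (\<Sum>k\<le>n. real (n choose k) * real k * ((-1) ^ (n - k) * (x + real k) ^ j))"
    unfolding alt_sum_def sum_distrib_left sum.distrib[symmetric]
    by (rule sum.cong) (simp_all add: algebra_simps)
  also have "(\<Sum>k\<le>n. real (n choose k) * real k * ((-1) ^ (n - k) * (x + real k) ^ j))
      = real n * alt_sum (n - 1) j (x + 1)"
    unfolding weighted_binomial_shift alt_sum_def by (simp add: algebra_simps)
  finally show ?thesis .
qed

lemma alt_sum_less: "j < n \<Longrightarrow> alt_sum n j x = 0"
  by (induction j arbitrary: n x) (simp_all add: alt_sum_0 alt_sum_Suc)

lemma alt_sum_same: "alt_sum n n x = fact n"
  by (induction n arbitrary: x) (simp_all add: alt_sum_0 alt_sum_Suc alt_sum_less)

lemma alt_sum_next: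
  "alt_sum n (Suc n) x = fact n * ((real n + 1) * x + real n * (real n + 1) / 2)"
proof (induction n arbitrary: x)
  case (Suc n)
  have "alt_sum (Suc n) (Suc (Suc n)) x
      = x * fact (Suc n) + real (Suc n) * alt_sum n (Suc n) (x + 1)"
    by (simp only: alt_sum_Suc[of "Suc n" "Suc n"] alt_sum_same diff_Suc_1)
  then show ?case by (simp add: Suc.IH field_simps)
qed (simp add: alt_sum_Suc alt_sum_0)

text \<open>
The coefficients that appear when an Abel sum with coefficients \<open>c\<close> is rewritten as a polynomial in
\<open>y + 1\<close>, as in the next lemma. For \<open>c k = (k + 1) ^ (k + j)\<close> the exponents add up to \<open>i + j\<close>, and the
coefficient is a finite difference of a single power.
\<close>

definition abel_diff :: "(nat \<Rightarrow> real) \<Rightarrow> nat \<Rightarrow> real" where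
  "abel_diff c i
    = (\<Sum>k\<le>i. real (i choose k) * (-1) ^ (i - k) * (c k * (real k + 1) ^ (i - k)))"

text \<open>
The exponent \<open>M - k\<close> on the left varies with \<open>k\<close>, which prevents a direct evaluation. Writing
\<open>y - k = (y + 1) - (k + 1)\<close> and expanding moves this dependence into the powers of \<open>k + 1\<close>, where it
combines with \<open>c k\<close>; collecting the terms with \<open>i = k + j\<close> gives the right-hand side.
\<close>

lemma abel_expansion:
  fixes y :: real
  shows "(\<Sum>k\<le>M. real (M choose k) * c k * (y - real k) ^ (M - k))
       = (\<Sum>i\<le>M. real (M choose i) * (y + 1) ^ (M - i) * abel_diff c i)"
proof -
  let ?g = "\<lambda>k j. real (M choose k) * real ((M - k) choose j) * c k
      * (- (real k + 1)) ^ j * (y + 1) ^ (M - k - j)"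
  have "(\<Sum>k\<le>M. real (M choose k) * c k * (y - real k) ^ (M - k))
      = (\<Sum>k\<le>M. \<Sum>j\<le>M - k. ?g k j)"
  proof (rule sum.cong[OF refl])
    fix k
    have "(y - real k) ^ (M - k) = (- (real k + 1) + (y + 1)) ^ (M - k)" by simp
    also have "\<dots> = (\<Sum>j\<le>M - k. real ((M - k) choose j) * (- (real k + 1)) ^ j * (y + 1) ^ (M - k - j))"
      by (rule binomial_ring)
    finally show "real (M choose k) * c k * (y - real k) ^ (M - k) = (\<Sum>j\<le>M - k. ?g k j)"
      by (simp add: sum_distrib_left mult_ac)
  qed
  also have "\<dots> = (\<Sum>(k, j)\<in>{(k, j). k + j \<le> M}. ?g k j)"
    by (subst sum.Sigma) (auto intro!: sum.cong)
  also have "\<dots> = (\<Sum>i\<le>M. \<Sum>k\<le>i. ?g k (i - k))"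
    by (rule sum.triangle_reindex_eq)
  also have "\<dots> = (\<Sum>i\<le>M. real (M choose i) * (y + 1) ^ (M - i) * abel_diff c i)"
  proof (rule sum.cong[OF refl])
    fix i assume i: "i \<in> {..M}"
    have "?g k (i - k) = real (M choose i) * (y + 1) ^ (M - i)
        * (real (i choose k) * (-1) ^ (i - k) * (c k * (real k + 1) ^ (i - k)))"
      if k: "k \<in> {..i}" for k
    proof -
      have "real (M choose k) * real ((M - k) choose (i - k)) = real (M choose i) * real (i choose k)"
        using choose_mult[of k i M] i k by (simp flip: of_nat_mult)
      moreover have "(- (real k + 1)) ^ (i - k) = (-1) ^ (i - k) * (real k + 1) ^ (i - k)"
        by (rule power_minus)
      moreover have "M - k - (i - k) = M - i" using k by simp
      ultimately show ?thesis by (simp add: mult_ac)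
    qed
    then show "(\<Sum>k\<le>i. ?g k (i - k)) = real (M choose i) * (y + 1) ^ (M - i) * abel_diff c i"
      unfolding abel_diff_def sum_distrib_left by (rule sum.cong[OF refl]) 
  qed
  finally show ?thesis .
qed

text \<open>
The number of parking functions for \<open>M \<le> n\<close> cars on \<open>n\<close> spots. Its usual form is
\<open>(n - M + 1) (n + 1) ^ (M - 1)\<close>; the expanded form also has the right value \<open>1\<close> at \<open>M = 0\<close>, and it
exhibits the number as a difference of two powers, which is what \<open>abel_expansion\<close> needs.
\<close>

definition park_count :: "nat \<Rightarrow> nat \<Rightarrow> real" where
  "park_count M n = (real n + 1) ^ M - real M * (real n + 1) ^ (M - 1)"

text \<open>
The two powers in \<^const>\<open>park_count\<close> contribute an Abel sum of order \<open>M\<close> and, after absorbing the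
factor \<open>M - k\<close>, \<open>M\<close> times the Abel sum of order \<open>M - 1\<close>. Absorbing \<open>M\<close> back aligns the two
expansions in powers of \<open>n + 1\<close>.
\<close>

lemma park_count_convolution:
  assumes "M < n"
  shows "(\<Sum>k\<le>M. real (M choose k) * c k * park_count (M - k) (n - k - 1))
       = (\<Sum>i\<le>M. real (M choose i) * (real n + 1) ^ (M - i)
            * (abel_diff c i - real i * abel_diff c (i - 1)))"
proof -
  define K where "K m = (\<Sum>k\<le>m. real (m choose k) * c k * (real n - real k) ^ (m - k))" for m
  have K: "K m = (\<Sum>i\<le>m. real (m choose i) * (real n + 1) ^ (m - i) * abel_diff c i)" for m
    unfolding K_def by (rule abel_expansion)
  have "(\<Sum>k\<le>M. real (M choose k) * c k * park_count (M - k) (n - k - 1))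
      = K M - (\<Sum>k\<le>M. real (M choose k) * real (M - k) * (c k * (real n - real k) ^ (M - k - 1)))"
    unfolding K_def sum_subtractf[symmetric]
  proof (rule sum.cong[OF refl])
    fix k assume "k \<in> {..M}"
    then have "real (n - k - 1) + 1 = real n - real k" using assms by auto
    then show "real (M choose k) * c k * park_count (M - k) (n - k - 1)
      = real (M choose k) * c k * (real n - real k) ^ (M - k)
        - real (M choose k) * real (M - k) * (c k * (real n - real k) ^ (M - k - 1))"
      unfolding park_count_def by (simp add: algebra_simps)
  qed
  also have "(\<Sum>k\<le>M. real (M choose k) * real (M - k) * (c k * (real n - real k) ^ (M - k - 1)))
      = real M * K (M - 1)"
  proof (cases M)
    case (Suc N)
    have absorb: "real (M choose k) * real (M - k) = real M * real (N choose k)" for k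
      using binomial_absorb_comp[of M k] Suc by (metis diff_Suc_1 mult.commute of_nat_mult)
    have "(\<Sum>k\<le>M. real (M choose k) * real (M - k) * (c k * (real n - real k) ^ (M - k - 1)))
       = (\<Sum>k\<le>N. real M * real (N choose k) * (c k * (real n - real k) ^ (N - k)))"
      unfolding absorb by (simp add: Suc)
    then show ?thesis unfolding K_def Suc by (simp add: sum_distrib_left mult_ac)
  qed simp
  also have "real M * K (M - 1)
      = (\<Sum>i\<le>M. real (M choose i) * real i * ((real n + 1) ^ (M - i) * abel_diff c (i - 1)))"
    unfolding K by (subst weighted_binomial_shift) (auto simp: mult_ac)
  also have "K M - \<dots> = (\<Sum>i\<le>M. real (M choose i) * (real n + 1) ^ (M - i)
            * (abel_diff c i - real i * abel_diff c (i - 1)))"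
    unfolding K sum_subtractf[symmetric] by (simp add: algebra_simps)
  finally show ?thesis .
qed

text \<open>
The number of classical parking functions of length \<open>k\<close>. The truncated exponent gives \<open>1\<close> at \<open>k = 0\<close>.
\<close>

definition full_count :: "nat \<Rightarrow> real" where
  "full_count k = (real k + 1) ^ (k - 1)"

lemma full_count_eq_park_count: "full_count k = park_count k k"
  by (cases k) (simp_all add: full_count_def park_count_def algebra_simps)

lemma power_split_real: "k \<le> i \<Longrightarrow> (x::real) ^ (k + j) * x ^ (i - k) = x ^ (i + j)"
  by (simp add: add.commute flip: power_add)

lemma abel_diff_power:
  assumes "\<And>k. c k = (real k + 1) ^ (k + j)"
  shows "abel_diff c i = alt_sum i (i + j) 1"
  unfolding abel_diff_def alt_sum_def
  by (rule sum.cong) (auto simp: assms power_split_real add.commute[of 1])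

text \<open>
This is Abel's identity: in positive degree \<open>i\<close> the coefficient is the \<open>i\<close>-th difference of a power
of degree \<open>i - 1\<close>.
\<close>

lemma abel_diff_full_count: "abel_diff full_count i = (if i = 0 then 1 else 0)"
proof (cases i)
  case (Suc l)
  have "abel_diff full_count i = alt_sum i l 1"
    unfolding abel_diff_def alt_sum_def
  proof (rule sum.cong[OF refl])
    fix k assume "k \<in> {..i}"
    then have "full_count k * (real k + 1) ^ (i - k) = (1 + real k) ^ l"
      by (cases k) (simp_all add: full_count_def Suc add.commute flip: power_add)
    then show "real (i choose k) * (-1) ^ (i - k) * (full_count k * (real k + 1) ^ (i - k))
      = real (i choose k) * (-1) ^ (i - k) * (1 + real k) ^ l" by simp
  qed
  then show ?thesis using Suc by (simp add: alt_sum_less)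
qed (simp add: abel_diff_def full_count_def)

lemma abel_diff_diff: "abel_diff (\<lambda>k. f k - g k) i = abel_diff f i - abel_diff g i"
  unfolding abel_diff_def by (simp add: algebra_simps sum_subtractf)

lemma full_count_times: "full_count k * (real k + 1) = (real k + 1) ^ k"
  by (cases k) (simp_all add: full_count_def)

text \<open>
The factor \<open>k = (k + 1) - 1\<close> raises the degree by one, so that the \<open>i\<close>-th difference of a power of
degree \<open>i\<close> appears, which is a factorial.
\<close>

lemma abel_diff_full_count_length:
  "abel_diff (\<lambda>k. full_count k * real k) i = fact i - (if i = 0 then 1 else 0)"
proof -
  have "full_count k * real k = (real k + 1) ^ k - full_count k" for k
    using full_count_times[of k] by (simp add: algebra_simps)
  then have "abel_diff (\<lambda>k. full_count k * real k) i
      = abel_diff (\<lambda>k. (real k + 1) ^ k) i - abel_diff full_count i"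
    by (simp add: abel_diff_diff)
  then show ?thesis
    by (simp add: abel_diff_power[where j = 0] alt_sum_same abel_diff_full_count)
qed

lemma abel_diff_full_count_triangle:
  "abel_diff (\<lambda>k. full_count k * (real k * (real k + 1))) i
    = fact i * (real i * (real i + 3) / 2)"
proof -
  have "full_count k * (real k * (real k + 1)) = (real k + 1) ^ (k + 1) - (real k + 1) ^ k" for k
  proof -
    have "full_count k * (real k * (real k + 1)) = real k * (full_count k * (real k + 1))"
      by (simp only: mult_ac)
    then show ?thesis unfolding full_count_times by (simp add: algebra_simps)
  qed
  then have "abel_diff (\<lambda>k. full_count k * (real k * (real k + 1))) i
      = abel_diff (\<lambda>k. (real k + 1) ^ (k + 1)) i - abel_diff (\<lambda>k. (real k + 1) ^ k) i"
    by (simp only: abel_diff_diff)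
  also have "\<dots> = alt_sum i (Suc i) 1 - alt_sum i i 1"
    by (simp add: abel_diff_power[where j = 0] abel_diff_power[where j = 1])
  finally show ?thesis
    by (simp add: alt_sum_same alt_sum_next field_simps)
qed

text \<open>
This sum, and the two below with the factors \<open>k\<close> and \<open>k (k + 1)\<close>, weight the length \<open>k\<close> of
the full block at one end of the street by the number of ways to fill the block, to fill the part
beyond the gap, and to interleave the two groups of cars.
\<close>

lemma sum_park_count_by_run:
  assumes "M < n"
  shows "(\<Sum>k\<le>M. real (M choose k) * full_count k * park_count (M - k) (n - k - 1)) = park_count M n"
proof -
  have "(\<Sum>k\<le>M. real (M choose k) * full_count k * park_count (M - k) (n - k - 1))
      = (\<Sum>i\<le>M. real (M choose i) * (real n + 1) ^ (M - i)
            * (if i = 0 then 1 else if i = 1 then - 1 else 0))"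
    unfolding park_count_convolution[OF assms] by (rule sum.cong) (auto simp: abel_diff_full_count)
  also have "\<dots> = (\<Sum>i\<le>M. (if i = 0 then (real n + 1) ^ M else 0)
      - (if i = 1 then real M * (real n + 1) ^ (M - 1) else 0))"
    by (rule sum.cong) auto
  also have "\<dots> = park_count M n"
    unfolding sum_subtractf by (auto simp: park_count_def not_le)
  finally show ?thesis .
qed

text \<open>
The coefficients \<open>i! - i (i - 1)!\<close> cancel for \<open>i \<ge> 2\<close>, which leaves a single term.
\<close>

lemma sum_run_length:
  assumes "M < n"
  shows "(\<Sum>k\<le>M. real (M choose k) * (full_count k * real k) * park_count (M - k) (n - k - 1))
       = real M * (real n + 1) ^ (M - 1)"
proof -
  have "abel_diff (\<lambda>k. full_count k * real k) i
      - real i * abel_diff (\<lambda>k. full_count k * real k) (i - 1) = (if i = 1 then 1 else 0)" for i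
    unfolding abel_diff_full_count_length by (cases i) auto
  then have "(\<Sum>k\<le>M. real (M choose k) * (full_count k * real k) * park_count (M - k) (n - k - 1))
      = (\<Sum>i\<le>M. if i = 1 then real M * (real n + 1) ^ (M - 1) else 0)"
    unfolding park_count_convolution[OF assms] by (intro sum.cong) auto
  then show ?thesis by (auto simp: not_le)
qed

text \<open>
Equal to \<open>M!\<close> times the sum of \<open>s ^ j / j!\<close> over \<open>j \<le> M\<close>, the partial exponential series that
makes up a Poisson distribution function.
\<close>

definition poisson_sum :: "nat \<Rightarrow> real \<Rightarrow> real" where
  "poisson_sum M s = (\<Sum>i\<le>M. real (M choose i) * fact i * s ^ (M - i))"

text \<open>
Telescoping, since the factor \<open>M - i\<close> turns the \<open>i\<close>-th falling factorial of \<open>M\<close> into the next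
one. In \<open>sum_run_triangle\<close> this removes the factor \<open>i + 1\<close> from the coefficients.
\<close>

lemma poisson_sum_telescope:
  "(\<Sum>i\<le>M. real (M choose i) * fact i * (s - real (M - i)) * s ^ (M - i)) = s ^ Suc M"
proof -
  define f where "f i = real (M choose i) * fact i * s ^ (Suc M - i)" for i
  have "real (M choose i) * fact i * (s - real (M - i)) * s ^ (M - i) = f i - f (Suc i)"
    if "i \<le> M" for i
  proof -
    have "real (M choose Suc i) * fact (Suc i) = real (M choose i) * fact i * real (M - i)"
    proof -
      have "Suc i * (M choose Suc i) = (M choose i) * (M - i)"
      proof (cases M)
        case (Suc N)
        then show ?thesis
          using binomial_absorb_comp[of M i] Suc_times_binomial[of i N] by (simp add: mult.commute)
      qed simp
      then have "real (Suc i) * real (M choose Suc i) = real (M choose i) * real (M - i)"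
        by (metis of_nat_mult)
      then show ?thesis by (simp add: mult_ac)
    qed
    then have "f (Suc i) = real (M choose i) * fact i * real (M - i) * s ^ (M - i)"
      unfolding f_def by simp
    then show ?thesis using that by (simp add: f_def Suc_diff_le algebra_simps)
  qed
  then have "(\<Sum>i\<le>M. real (M choose i) * fact i * (s - real (M - i)) * s ^ (M - i))
      = (\<Sum>i\<le>M. f i - f (Suc i))" by simp
  also have "\<dots> = f 0 - f (Suc M)" by (rule sum_telescope)
  also have "\<dots> = s ^ Suc M" by (simp add: f_def)
  finally show ?thesis .
qed

text \<open>
Here the coefficients of the powers of \<open>n + 1\<close> do not cancel: for \<open>i > 0\<close> they are \<open>(i + 1) i!\<close>
times the binomial coefficient, the source of the truncated exponential sum.
\<close>

lemma sum_run_triangle: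
  assumes "M < n"
  shows "(\<Sum>k\<le>M. real (M choose k) * (full_count k * (real k * (real k + 1)))
             * park_count (M - k) (n - k - 1))
       = real n * (real n + 1) ^ M - (real n - real M) * poisson_sum M (real n + 1)"
proof -
  let ?c = "\<lambda>k. full_count k * (real k * (real k + 1))"
  let ?s = "real n + 1"
  have "abel_diff ?c i - real i * abel_diff ?c (i - 1)
      = fact i * (real i + 1) - (if i = 0 then 1 else 0)" for i
    unfolding abel_diff_full_count_triangle by (cases i) (auto simp: field_simps)
  then have "(\<Sum>k\<le>M. real (M choose k) * ?c k * park_count (M - k) (n - k - 1))
      = (\<Sum>i\<le>M. real (M choose i) * fact i * (real i + 1) * ?s ^ (M - i)
           - (if i = 0 then ?s ^ M else 0))"
    unfolding park_count_convolution[OF assms]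
    by (intro sum.cong[OF refl]) (simp only:, simp add: algebra_simps)
  \<comment> \<open>Here \<open>i + 1 = (n + 1 - (M - i)) - (n - M)\<close>.\<close>
  also have "\<dots> = (\<Sum>i\<le>M. real (M choose i) * fact i * (?s - real (M - i)) * ?s ^ (M - i)
       - (real n - real M) * (real (M choose i) * fact i * ?s ^ (M - i))) - ?s ^ M"
    unfolding sum_subtractf[of "\<lambda>i. real (M choose i) * fact i * (real i + 1) * ?s ^ (M - i)"]
    by (auto intro!: arg_cong2[where f = minus] sum.cong simp: of_nat_diff algebra_simps)
  also have "\<dots> = ?s ^ Suc M - (real n - real M) * poisson_sum M ?s - ?s ^ M"
    unfolding sum_subtractf poisson_sum_telescope poisson_sum_def sum_distrib_left ..
  finally show ?thesis by (simp add: algebra_simps)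
qed

section \<open>Weights of sets of occupied spots\<close>

definition left_run :: "nat set \<Rightarrow> nat \<Rightarrow> nat" where
  "left_run S s = card {a. a < s \<and> {a..<s} \<subseteq> S}"

definition right_run :: "nat set \<Rightarrow> nat \<Rightarrow> nat" where
  "right_run S s = card {b. s < b \<and> {s<..b} \<subseteq> S}"

text \<open>
The expected number of preferences \<open>b\<close> that send a car to spot \<open>s\<close>, when \<open>S\<close> is the set of occupied
spots after this car has parked: \<open>b = s\<close> itself, the spots of the run left of \<open>s\<close> if the car moves
forward, and the spots of the run right of \<open>s\<close> if it moves backward.
\<close>

definition spot_rate :: "real \<Rightarrow> nat set \<Rightarrow> nat \<Rightarrow> real" where
  "spot_rate p S s = 1 + p * real (left_run S s) + (1 - p) * real (right_run S s)"

text \<open>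
The weight \<open>w(S)\<close> of the introduction, by recursion on the spot \<open>s\<close> that was taken last; the first
argument after \<open>p\<close> is the number of cars. The length of the street does not occur: a run of occupied
spots stays within \<open>S\<close>.
\<close>

fun park_weight :: "real \<Rightarrow> nat \<Rightarrow> nat set \<Rightarrow> real" where
  "park_weight p 0 S = (if S = {} then 1 else 0)"
| "park_weight p (Suc k) S = (\<Sum>s\<in>S. park_weight p k (S - {s}) * spot_rate p S s)"

text \<open>
A run cannot cross the free spot \<open>g\<close>.
\<close>

lemma spot_rate_below_gap:
  assumes "A \<subseteq> {..<g}" "B \<subseteq> {g<..}" "s \<in> A"
  shows "spot_rate p (A \<union> B) s = spot_rate p A s"
proof -
  have "s < g" using assms by auto
  have "{a. a < s \<and> {a..<s} \<subseteq> A \<union> B} = {a. a < s \<and> {a..<s} \<subseteq> A}"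
    using assms(2) \<open>s < g\<close> by fastforce
  moreover have "{s<..b} \<subseteq> A" if b: "{s<..b} \<subseteq> A \<union> B" for b
  proof -
    have "g \<notin> A \<union> B" using assms by auto
    then have "b < g" using b \<open>s < g\<close> by (meson greaterThanAtMost_iff not_le subsetD)
    then show ?thesis using b assms(2) by fastforce
  qed
  then have "{b. s < b \<and> {s<..b} \<subseteq> A \<union> B} = {b. s < b \<and> {s<..b} \<subseteq> A}" by blast
  ultimately show ?thesis unfolding spot_rate_def left_run_def right_run_def by presburger
qed

lemma spot_rate_above_gap:
  assumes "A \<subseteq> {..<g}" "B \<subseteq> {g<..}" "s \<in> B"
  shows "spot_rate p (A \<union> B) s = spot_rate p B s"
proof -
  have "g < s" using assms by auto
  have "{b. s < b \<and> {s<..b} \<subseteq> A \<union> B} = {b. s < b \<and> {s<..b} \<subseteq> B}"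
    using assms(1) \<open>g < s\<close> by fastforce
  moreover have "{a..<s} \<subseteq> B" if a: "{a..<s} \<subseteq> A \<union> B" for a
  proof -
    have "g \<notin> A \<union> B" using assms by auto
    then have "g < a" using a \<open>g < s\<close> by (meson atLeastLessThan_iff not_le subsetD)
    then show ?thesis using a assms(1) by fastforce
  qed
  then have "{a. a < s \<and> {a..<s} \<subseteq> A \<union> B} = {a. a < s \<and> {a..<s} \<subseteq> B}" by blast
  ultimately show ?thesis unfolding spot_rate_def left_run_def right_run_def by presburger
qed

text \<open>
The cars on the two sides of a gap do not influence each other, and the binomial coefficient counts
the ways to interleave their arrivals. Formally the last car is on one of the two sides, and the two
resulting sums are added with Pascal's rule.
\<close>

lemma park_weight_split:
  assumes "finite A" "finite B" "A \<subseteq> {..<g}" "B \<subseteq> {g<..}"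
  shows "park_weight p (card A + card B) (A \<union> B)
    = real ((card A + card B) choose card A) * park_weight p (card A) A * park_weight p (card B) B"
  using assms
proof (induction "card A + card B" arbitrary: A B)
  case 0
  then show ?case by simp
next
  case (Suc N)
  have disj: "A \<inter> B = {}" using Suc.prems by fastforce
  have "park_weight p (Suc N) (A \<union> B)
      = (\<Sum>s\<in>A. park_weight p N (A \<union> B - {s}) * spot_rate p (A \<union> B) s)
      + (\<Sum>s\<in>B. park_weight p N (A \<union> B - {s}) * spot_rate p (A \<union> B) s)"
    using Suc.prems disj by (simp add: sum.union_disjoint)
  also have "(\<Sum>s\<in>A. park_weight p N (A \<union> B - {s}) * spot_rate p (A \<union> B) s)
      = (if A = {} then 0 else real (N choose (card A - 1))) * park_weight p (card A) A
          * park_weight p (card B) B"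
  proof (cases "card A")
    case 0
    then show ?thesis using Suc.prems by simp
  next
    case (Suc i)
    have "park_weight p N (A \<union> B - {s}) * spot_rate p (A \<union> B) s
        = real (N choose i) * park_weight p (card B) B * (park_weight p i (A - {s}) * spot_rate p A s)"
      if s: "s \<in> A" for s
    proof -
      have c: "card (A - {s}) = i" using Suc s Suc.prems by simp
      have "A \<union> B - {s} = (A - {s}) \<union> B" using s disj by auto
      moreover have "N = card (A - {s}) + card B" using Suc c Suc.hyps(2) by simp
      moreover have "A - {s} \<subseteq> {..<g}" using Suc.prems by auto
      ultimately have "park_weight p N (A \<union> B - {s})
          = real (N choose i) * park_weight p i (A - {s}) * park_weight p (card B) B"
        using Suc.hyps(1)[of "A - {s}" B] Suc.prems c by simp
      then show ?thesis using spot_rate_below_gap[OF Suc.prems(3,4) s] by simp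
    qed
    moreover have "A \<noteq> {}" using Suc by auto
    ultimately show ?thesis using Suc by (simp add: sum_distrib_left sum_distrib_right mult_ac)
  qed
  also have "(\<Sum>s\<in>B. park_weight p N (A \<union> B - {s}) * spot_rate p (A \<union> B) s)
      = (if B = {} then 0 else real (N choose card A)) * park_weight p (card A) A
          * park_weight p (card B) B"
  proof (cases "card B")
    case 0
    then show ?thesis using Suc.prems by simp
  next
    case (Suc i)
    have "park_weight p N (A \<union> B - {s}) * spot_rate p (A \<union> B) s
        = real (N choose card A) * park_weight p (card A) A * (park_weight p i (B - {s}) * spot_rate p B s)"
      if s: "s \<in> B" for s
    proof -
      have c: "card (B - {s}) = i" using Suc s Suc.prems by simp
      have "A \<union> B - {s} = A \<union> (B - {s})" using s disj by auto
      moreover have "N = card A + card (B - {s})" using Suc c Suc.hyps(2) by simp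
      moreover have "B - {s} \<subseteq> {g<..}" using Suc.prems by auto
      ultimately have "park_weight p N (A \<union> B - {s})
          = real (N choose card A) * park_weight p (card A) A * park_weight p i (B - {s})"
        using Suc.hyps(1)[of A "B - {s}"] Suc.prems c by simp
      then show ?thesis using spot_rate_above_gap[OF Suc.prems(3,4) s] by simp
    qed
    moreover have "B \<noteq> {}" using Suc by auto
    ultimately show ?thesis using Suc by (simp add: sum_distrib_left sum_distrib_right mult_ac)
  qed
  also have "(if A = {} then 0 else real (N choose (card A - 1))) * park_weight p (card A) A
          * park_weight p (card B) B
      + (if B = {} then 0 else real (N choose card A)) * park_weight p (card A) A
          * park_weight p (card B) B
      = ((if A = {} then 0 else real (N choose (card A - 1)))
          + (if B = {} then 0 else real (N choose card A)))
        * park_weight p (card A) A * park_weight p (card B) B"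
    by (simp only: distrib_right)
  also have "(if A = {} then 0 else real (N choose (card A - 1)))
        + (if B = {} then 0 else real (N choose card A)) = real (Suc N choose card A)"
  proof (cases "card A")
    case 0
    then have "A = {}" "B \<noteq> {}" using Suc.prems Suc.hyps(2) by auto
    then show ?thesis by simp
  next
    case (Suc i)
    then have "A \<noteq> {}" by auto
    moreover have "N choose card A = 0" if "B = {}"
      using that Suc.hyps(2) by (simp add: binomial_eq_0)
    ultimately show ?thesis using Suc by auto
  qed
  finally show ?case using Suc.hyps(2) by simp
qed

lemma spot_rate_interval:
  assumes "i \<le> N"
  shows "spot_rate p {a<..a + Suc N} (a + Suc i) = 1 + p * real i + (1 - p) * real (N - i)"
proof -
  have "{x. x < a + Suc i \<and> {x..<a + Suc i} \<subseteq> {a<..a + Suc N}} = {a<..<a + Suc i}"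
    using assms by fastforce
  moreover have "{x. a + Suc i < x \<and> {a + Suc i<..x} \<subseteq> {a<..a + Suc N}} = {a + Suc i<..a + Suc N}"
    using assms by fastforce
  ultimately show ?thesis
    unfolding spot_rate_def left_run_def right_run_def by simp
qed

text \<open>
Removing the last spot from a full interval of \<open>N + 1\<close> spots leaves intervals of lengths \<open>i\<close> and
\<open>N - i\<close>, and the rate is \<open>1 + p i + (1 - p) (N - i)\<close>. The other factors are symmetric under
\<open>i \<mapsto> N - i\<close>, and adding the reflected sum replaces the rate by \<open>N + 2\<close>, so that \<open>p\<close> drops out. What
remains is \<open>sum_park_count_by_run\<close> on \<open>N + 1\<close> spots with \<open>N\<close> cars.
\<close>

lemma park_weight_interval: "park_weight p k {a<..a + k} = full_count k"
proof (induction k arbitrary: a rule: less_induct)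
  case (less k)
  show ?case
  proof (cases k)
    case 0
    then show ?thesis by (simp add: full_count_def)
  next
    case (Suc N)
    let ?t = "\<lambda>i. real (N choose i) * full_count i * full_count (N - i)"
    have step: "park_weight p N ({a<..a + Suc N} - {a + Suc i}) = ?t i" if i: "i \<le> N" for i
    proof -
      have "{a<..a + Suc N} - {a + Suc i} = {a<..a + i} \<union> {a + Suc i<..a + Suc i + (N - i)}"
        using i by auto
      moreover have "park_weight p i {a<..a + i} = full_count i"
        "park_weight p (N - i) {a + Suc i<..a + Suc i + (N - i)} = full_count (N - i)"
        using less.IH[of i a] less.IH[of "N - i" "a + Suc i"] i Suc by simp_all
      ultimately show ?thesis
        using park_weight_split[of "{a<..a + i}" "{a + Suc i<..a + Suc i + (N - i)}" "a + Suc i" p] i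
        by (simp add: subset_iff)
    qed
    have im: "{a<..a + Suc N} = (\<lambda>i. a + Suc i) ` {..N}"
    proof (intro subset_antisym subsetI)
      fix x assume "x \<in> {a<..a + Suc N}"
      then have "x = a + Suc (x - a - 1)" "x - a - 1 \<in> {..N}" by auto
      then show "x \<in> (\<lambda>i. a + Suc i) ` {..N}" by (rule image_eqI)
    qed auto
    have W: "park_weight p k {a<..a + k} = (\<Sum>i\<le>N. ?t i * (1 + p * real i + (1 - p) * real (N - i)))"
    proof -
      have "park_weight p k {a<..a + k} = (\<Sum>s\<in>(\<lambda>i. a + Suc i) ` {..N}.
          park_weight p N ({a<..a + Suc N} - {s}) * spot_rate p {a<..a + Suc N} s)"
        unfolding Suc park_weight.simps im[symmetric] ..
      also have "\<dots> = (\<Sum>i\<le>N. park_weight p N ({a<..a + Suc N} - {a + Suc i})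
           * spot_rate p {a<..a + Suc N} (a + Suc i))"
        by (subst sum.reindex) (auto simp: inj_on_def)
      finally show ?thesis using step spot_rate_interval by simp
    qed
    also have "\<dots> = (\<Sum>i\<le>N. ?t (N - i) * (1 + p * real (N - i) + (1 - p) * real (N - (N - i))))"
      using sum.nat_diff_reindex[of "\<lambda>i. ?t i * (1 + p * real i + (1 - p) * real (N - i))" "Suc N"]
      by (simp only: lessThan_Suc_atMost diff_Suc_Suc)
    also have "\<dots> = (\<Sum>i\<le>N. ?t i * (1 + p * real (N - i) + (1 - p) * real i))"
      by (intro sum.cong refl) (simp add: binomial_symmetric[symmetric] mult_ac)
    finally have W': "park_weight p k {a<..a + k}
        = (\<Sum>i\<le>N. ?t i * (1 + p * real (N - i) + (1 - p) * real i))" .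
    have "2 * park_weight p k {a<..a + k} = (\<Sum>i\<le>N. ?t i * (real N + 2))"
    proof -
      have "2 * park_weight p k {a<..a + k}
          = (\<Sum>i\<le>N. ?t i * (1 + p * real i + (1 - p) * real (N - i)))
          + (\<Sum>i\<le>N. ?t i * (1 + p * real (N - i) + (1 - p) * real i))"
        using W W' by linarith
      also have "\<dots> = (\<Sum>i\<le>N. ?t i * (1 + p * real i + (1 - p) * real (N - i))
          + ?t i * (1 + p * real (N - i) + (1 - p) * real i))"
        by (rule sum.distrib[symmetric])
      also have "\<dots> = (\<Sum>i\<le>N. ?t i * (real N + 2))"
      proof (rule sum.cong[OF refl])
        fix i assume "i \<in> {..N}"
        then have "(1 + p * real i + (1 - p) * real (N - i))
            + (1 + p * real (N - i) + (1 - p) * real i) = real N + 2"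
          by (simp add: of_nat_diff algebra_simps)
        then show "?t i * (1 + p * real i + (1 - p) * real (N - i))
          + ?t i * (1 + p * real (N - i) + (1 - p) * real i) = ?t i * (real N + 2)"
          by (simp only: distrib_left[symmetric])
      qed
      finally show ?thesis .
    qed
    also have "\<dots> = park_count N (Suc N) * (real N + 2)"
      unfolding sum_distrib_right[symmetric]
      by (subst sum_park_count_by_run[OF lessI, symmetric]) (simp add: full_count_eq_park_count)
    also have "\<dots> = 2 * full_count k"
      unfolding Suc park_count_def full_count_def by (cases N) (simp_all add: algebra_simps)
    finally show ?thesis by simp
  qed
qed

section \<open>Splitting off the full block at an end of the street\<close>

definition spot_sets :: "nat \<Rightarrow> nat \<Rightarrow> nat \<Rightarrow> nat set set" where
  "spot_sets a b M = {S. S \<subseteq> {a<..b} \<and> card S = M}"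

lemma finite_spot_sets: "finite (spot_sets a b M)"
  unfolding spot_sets_def by (rule finite_subset[of _ "Pow {a<..b}"]) auto

lemma spot_setsD: "S \<in> spot_sets a b M \<Longrightarrow> S \<subseteq> {a<..b} \<and> finite S \<and> card S = M"
  unfolding spot_sets_def using finite_subset by auto

text \<open>
The set is cut at its last free spot \<open>b - k\<close>. Such a spot exists because there are fewer than
\<open>b - a\<close> cars.
\<close>

lemma sum_by_last_gap:
  assumes "M < b - a"
  shows "(\<Sum>S\<in>spot_sets a b M. f S)
       = (\<Sum>k\<le>M. \<Sum>S\<in>spot_sets a (b - k - 1) (M - k). f (S \<union> {b - k<..b}))"
proof -
  let ?D = "SIGMA k:{..M}. spot_sets a (b - k - 1) (M - k)"
  have free: "b - k \<notin> S \<union> {b - k<..b}" if "(k, S) \<in> ?D" for k S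
  proof -
    have "S \<subseteq> {a<..b - k - 1}" "k \<le> M" using that by (auto dest: spot_setsD)
    then show ?thesis using assms by (auto dest!: subsetD)
  qed
  have "bij_betw (\<lambda>(k, S). S \<union> {b - k<..b}) ?D (spot_sets a b M)"
    unfolding bij_betw_def
  proof
    have not_less: "\<not> k < k'"
      if "(k, S) \<in> ?D" "(k', S') \<in> ?D" "S \<union> {b - k<..b} = S' \<union> {b - k'<..b}" for k S k' S'
    proof
      assume "k < k'"
      then have "b - k \<in> S' \<union> {b - k'<..b}" using that(2) assms by auto
      then show False using free[OF that(1)] that(3) by simp
    qed
    have same: "S = (S \<union> {b - k<..b}) - {b - k<..b}" if "(k, S) \<in> ?D" for k S
    proof -
      have "S \<subseteq> {a<..b - k - 1}" using that by (auto dest: spot_setsD)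
      then have "S \<inter> {b - k<..b} = {}" by fastforce
      then show ?thesis by blast
    qed
    show "inj_on (\<lambda>(k, S). S \<union> {b - k<..b}) ?D"
    proof (rule inj_onI)
      fix x y
      assume D: "x \<in> ?D" "y \<in> ?D"
        and xy: "(\<lambda>(k, S). S \<union> {b - k<..b}) x = (\<lambda>(k, S). S \<union> {b - k<..b}) y"
      obtain k S k' S' where x: "x = (k, S)" and y: "y = (k', S')" by (metis surj_pair)
      have D': "(k, S) \<in> ?D" "(k', S') \<in> ?D" and eq: "S \<union> {b - k<..b} = S' \<union> {b - k'<..b}"
        using D xy unfolding x y by simp_all
      have k: "k = k'" using not_less[OF D' eq] not_less[OF D'(2,1) eq[symmetric]] by simp
      moreover have "S = S'" using same[OF D'(1)] same[OF D'(2)] eq k by metis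
      ultimately show "x = y" using x y by simp
    qed
    show "(\<lambda>(k, S). S \<union> {b - k<..b}) ` ?D = spot_sets a b M"
    proof (intro subset_antisym subsetI)
      fix S assume "S \<in> (\<lambda>(k, S). S \<union> {b - k<..b}) ` ?D"
      then obtain k T where k: "k \<le> M" and T: "T \<in> spot_sets a (b - k - 1) (M - k)"
        and S: "S = T \<union> {b - k<..b}" by auto
      have "T \<inter> {b - k<..b} = {}" using spot_setsD[OF T] by fastforce
      then have "card S = M" using spot_setsD[OF T] k assms S by (simp add: card_Un_disjoint)
      moreover have "S \<subseteq> {a<..b}" using spot_setsD[OF T] S assms k by fastforce
      ultimately show "S \<in> spot_sets a b M" by (simp add: spot_sets_def)
    next
      fix S assume S: "S \<in> spot_sets a b M"
      let ?F = "{a<..b} - S"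
      have "?F \<noteq> {}"
      proof
        assume "?F = {}"
        then have "card {a<..b} \<le> card S" using spot_setsD[OF S] by (intro card_mono) auto
        then show False using spot_setsD[OF S] assms by simp
      qed
      then have g: "Max ?F \<in> ?F" by (intro Max_in) auto
      define g where "g = Max ?F"
      have gS: "g \<in> {a<..b}" "g \<notin> S" using g by (auto simp: g_def)
      have tail: "{g<..b} \<subseteq> S"
      proof
        fix x assume x: "x \<in> {g<..b}"
        show "x \<in> S"
        proof (rule ccontr)
          assume "x \<notin> S"
          then have "x \<le> g" unfolding g_def using x gS by (intro Max_ge) auto
          then show False using x by simp
        qed
      qed
      have "card {g<..b} \<le> M" using spot_setsD[OF S] tail by (metis card_mono)
      then have kM: "b - g \<le> M" by simp
      have "S - {g<..b} \<subseteq> {a<..b - (b - g) - 1}"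
      proof
        fix x assume x: "x \<in> S - {g<..b}"
        then have "x \<noteq> g" "x \<in> {a<..b}" using gS spot_setsD[OF S] by auto
        then show "x \<in> {a<..b - (b - g) - 1}" using x gS by auto
      qed
      then have "S - {g<..b} \<in> spot_sets a (b - (b - g) - 1) (M - (b - g))"
        unfolding spot_sets_def using spot_setsD[OF S] tail by (auto simp: card_Diff_subset)
      moreover have "S = (S - {g<..b}) \<union> {b - (b - g)<..b}" using tail gS by auto
      ultimately show "S \<in> (\<lambda>(k, S). S \<union> {b - k<..b}) ` ?D"
        using kM by (intro image_eqI[of _ _ "(b - g, S - {g<..b})"]) auto
    qed
  qed
  then have "(\<Sum>S\<in>spot_sets a b M. f S) = (\<Sum>(k, S)\<in>?D. f (S \<union> {b - k<..b}))"
    by (subst sum.reindex_bij_betw[symmetric]) (auto simp: case_prod_unfold)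
  also have "\<dots> = (\<Sum>k\<le>M. \<Sum>S\<in>spot_sets a (b - k - 1) (M - k). f (S \<union> {b - k<..b}))"
    by (rule sum.Sigma[symmetric]) (auto intro: finite_spot_sets)
  finally show ?thesis .
qed

lemma sum_by_first_gap:
  assumes "M < b - a"
  shows "(\<Sum>S\<in>spot_sets a b M. f S)
       = (\<Sum>k\<le>M. \<Sum>S\<in>spot_sets (a + k + 1) b (M - k). f ({a<..a + k} \<union> S))"
proof -
  let ?D = "SIGMA k:{..M}. spot_sets (a + k + 1) b (M - k)"
  have free: "a + k + 1 \<notin> {a<..a + k} \<union> S" if "(k, S) \<in> ?D" for k S
  proof -
    have "S \<subseteq> {a + k + 1<..b}" using that by (auto dest: spot_setsD)
    then show ?thesis by (auto dest!: subsetD)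
  qed
  have "bij_betw (\<lambda>(k, S). {a<..a + k} \<union> S) ?D (spot_sets a b M)"
    unfolding bij_betw_def
  proof
    have not_less: "\<not> k < k'"
      if "(k, S) \<in> ?D" "(k', S') \<in> ?D" "{a<..a + k} \<union> S = {a<..a + k'} \<union> S'" for k S k' S'
    proof
      assume "k < k'"
      then have "a + k + 1 \<in> {a<..a + k'} \<union> S'" by auto
      then show False using free[OF that(1)] that(3) by simp
    qed
    have same: "S = ({a<..a + k} \<union> S) - {a<..a + k}" if "(k, S) \<in> ?D" for k S
    proof -
      have "S \<subseteq> {a + k + 1<..b}" using that by (auto dest: spot_setsD)
      then have "S \<inter> {a<..a + k} = {}" by fastforce
      then show ?thesis by blast
    qed
    show "inj_on (\<lambda>(k, S). {a<..a + k} \<union> S) ?D"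
    proof (rule inj_onI)
      fix x y
      assume D: "x \<in> ?D" "y \<in> ?D"
        and xy: "(\<lambda>(k, S). {a<..a + k} \<union> S) x = (\<lambda>(k, S). {a<..a + k} \<union> S) y"
      obtain k S k' S' where x: "x = (k, S)" and y: "y = (k', S')" by (metis surj_pair)
      have D': "(k, S) \<in> ?D" "(k', S') \<in> ?D" and eq: "{a<..a + k} \<union> S = {a<..a + k'} \<union> S'"
        using D xy unfolding x y by simp_all
      have k: "k = k'" using not_less[OF D' eq] not_less[OF D'(2,1) eq[symmetric]] by simp
      moreover have "S = S'" using same[OF D'(1)] same[OF D'(2)] eq k by metis
      ultimately show "x = y" using x y by simp
    qed
    show "(\<lambda>(k, S). {a<..a + k} \<union> S) ` ?D = spot_sets a b M"
    proof (intro subset_antisym subsetI)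
      fix S assume "S \<in> (\<lambda>(k, S). {a<..a + k} \<union> S) ` ?D"
      then obtain k T where k: "k \<le> M" and T: "T \<in> spot_sets (a + k + 1) b (M - k)"
        and S: "S = {a<..a + k} \<union> T" by auto
      have "{a<..a + k} \<inter> T = {}" using spot_setsD[OF T] by fastforce
      then have "card S = M" using spot_setsD[OF T] k S by (simp add: card_Un_disjoint)
      moreover have "S \<subseteq> {a<..b}" using spot_setsD[OF T] S assms k by fastforce
      ultimately show "S \<in> spot_sets a b M" by (simp add: spot_sets_def)
    next
      fix S assume S: "S \<in> spot_sets a b M"
      let ?F = "{a<..b} - S"
      have "?F \<noteq> {}"
      proof
        assume "?F = {}"
        then have "card {a<..b} \<le> card S" using spot_setsD[OF S] by (intro card_mono) auto
        then show False using spot_setsD[OF S] assms by simp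
      qed
      then have g: "Min ?F \<in> ?F" by (intro Min_in) auto
      define k where "k = Min ?F - a - 1"
      have k: "Min ?F = a + k + 1" using g by (auto simp: k_def)
      have gS: "a + k + 1 \<le> b" "a + k + 1 \<notin> S" using g unfolding k by auto
      have head: "{a<..a + k} \<subseteq> S"
      proof
        fix x assume x: "x \<in> {a<..a + k}"
        show "x \<in> S"
        proof (rule ccontr)
          assume "x \<notin> S"
          then have "Min ?F \<le> x" using x gS by (intro Min_le) auto
          then show False using x k by simp
        qed
      qed
      have "card {a<..a + k} \<le> M" using spot_setsD[OF S] head by (metis card_mono)
      then have kM: "k \<le> M" by simp
      have "S - {a<..a + k} \<subseteq> {a + k + 1<..b}"
      proof
        fix x assume x: "x \<in> S - {a<..a + k}"
        then have "x \<noteq> a + k + 1" using gS by auto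
        then show "x \<in> {a + k + 1<..b}" using x spot_setsD[OF S] by fastforce
      qed
      then have "S - {a<..a + k} \<in> spot_sets (a + k + 1) b (M - k)"
        unfolding spot_sets_def using spot_setsD[OF S] head by (auto simp: card_Diff_subset)
      moreover have "S = {a<..a + k} \<union> (S - {a<..a + k})" using head by auto
      ultimately show "S \<in> (\<lambda>(k, S). {a<..a + k} \<union> S) ` ?D"
        using kM by (intro image_eqI[of _ _ "(k, S - {a<..a + k})"]) auto
    qed
  qed
  then have "(\<Sum>S\<in>spot_sets a b M. f S) = (\<Sum>(k, S)\<in>?D. f ({a<..a + k} \<union> S))"
    by (subst sum.reindex_bij_betw[symmetric]) (auto simp: case_prod_unfold)
  also have "\<dots> = (\<Sum>k\<le>M. \<Sum>S\<in>spot_sets (a + k + 1) b (M - k). f ({a<..a + k} \<union> S))"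
    by (rule sum.Sigma[symmetric]) (auto intro: finite_spot_sets)
  finally show ?thesis .
qed

text \<open>
For a set that ends in a full block of length \<open>k\<close>, the gap before the block separates it from the
rest.
\<close>

lemma park_weight_tail:
  assumes "M < b - a" "k \<le> M" "S \<in> spot_sets a (b - k - 1) (M - k)"
  shows "park_weight p M (S \<union> {b - k<..b})
    = real (M choose k) * full_count k * park_weight p (M - k) S"
proof -
  have S: "S \<subseteq> {..<b - k}" "finite S" "card S = M - k"
    using spot_setsD[OF assms(3)] assms(1,2) by fastforce+
  have "park_weight p k {b - k<..b} = full_count k"
    using park_weight_interval[of p k "b - k"] assms by simp
  moreover have "M choose (M - k) = M choose k"
    using binomial_symmetric[OF assms(2)] by simp
  moreover have "park_weight p (card S + card {b - k<..b}) (S \<union> {b - k<..b})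
      = real ((card S + card {b - k<..b}) choose card S) * park_weight p (card S) S
          * park_weight p (card {b - k<..b}) {b - k<..b}"
    using S by (intro park_weight_split[where g = "b - k"]) auto
  moreover have "card {b - k<..b} = k" using assms(1,2) by simp
  moreover have "M - k + k = M" using assms(2) by simp
  ultimately show ?thesis unfolding S(3) by (simp only: mult_ac)
qed

lemma park_weight_head:
  assumes "M < b - a" "k \<le> M" "S \<in> spot_sets (a + k + 1) b (M - k)"
  shows "park_weight p M ({a<..a + k} \<union> S)
    = real (M choose k) * full_count k * park_weight p (M - k) S"
proof -
  have S: "S \<subseteq> {a + k + 1<..}" "finite S" "card S = M - k"
    using spot_setsD[OF assms(3)] by fastforce+
  have "park_weight p (card {a<..a + k} + card S) ({a<..a + k} \<union> S)
      = real ((card {a<..a + k} + card S) choose card {a<..a + k})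
          * park_weight p (card {a<..a + k}) {a<..a + k} * park_weight p (card S) S"
    using S by (intro park_weight_split[where g = "a + k + 1"]) auto
  moreover have "card {a<..a + k} = k" by simp
  moreover have "k + (M - k) = M" using assms(2) by simp
  ultimately show ?thesis unfolding S(3) park_weight_interval by (simp only: park_weight_interval)
qed

text \<open>
Induction on the length of the street, cutting at the last free spot. A street without a free spot is
the case of a full interval.
\<close>

lemma sum_park_weight:
  assumes "M \<le> b - a"
  shows "(\<Sum>S\<in>spot_sets a b M. park_weight p M S) = park_count M (b - a)"
  using assms
proof (induction "b - a" arbitrary: b M rule: less_induct)
  case less
  show ?case
  proof (cases "M = b - a")
    case True
    have "S = {a<..b}" if "S \<in> spot_sets a b M" for S
      using spot_setsD[OF that] True by (intro card_subset_eq) auto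
    then have sets: "spot_sets a b M = {{a<..b}}"
      using True by (auto simp: spot_sets_def)
    show ?thesis
    proof (cases "a \<le> b")
      case ab: True
      then show ?thesis unfolding sets using park_weight_interval[of p M a] True
        by (simp add: full_count_eq_park_count)
    next
      case False
      then show ?thesis using True sets by (simp add: park_count_def)
    qed
  next
    case False
    then have M: "M < b - a" using less.prems by simp
    have "(\<Sum>S\<in>spot_sets a b M. park_weight p M S)
        = (\<Sum>k\<le>M. \<Sum>S\<in>spot_sets a (b - k - 1) (M - k).
             real (M choose k) * full_count k * park_weight p (M - k) S)"
      unfolding sum_by_last_gap[OF M]
      by (intro sum.cong refl) (simp add: park_weight_tail[OF M])
    also have "\<dots> = (\<Sum>k\<le>M. real (M choose k) * full_count k * park_count (M - k) (b - a - k - 1))"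
    proof (rule sum.cong[OF refl])
      fix k assume "k \<in> {..M}"
      then have "M - k \<le> b - k - 1 - a" "b - k - 1 - a < b - a" using M by auto
      then have "(\<Sum>S\<in>spot_sets a (b - k - 1) (M - k). park_weight p (M - k) S)
          = park_count (M - k) (b - k - 1 - a)" using less.hyps by blast
      moreover have "b - k - 1 - a = b - a - k - 1" by simp
      ultimately show "(\<Sum>S\<in>spot_sets a (b - k - 1) (M - k).
             real (M choose k) * full_count k * park_weight p (M - k) S)
          = real (M choose k) * full_count k * park_count (M - k) (b - a - k - 1)"
        by (simp flip: sum_distrib_left)
    qed
    finally show ?thesis using sum_park_count_by_run[OF M] by simp
  qed
qed

text \<open>
Sums of a function of the tail, and likewise of the head below, reduce to sums over the block length.
The two right-hand sides agree and do not involve \<open>p\<close>, which is the symmetry between the two ends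
of the street.
\<close>

lemma sum_park_weight_tail:
  assumes "M < b - a"
    and "\<And>k S. k \<le> M \<Longrightarrow> S \<subseteq> {a<..<b - k} \<Longrightarrow> H (S \<union> {b - k<..b}) = h k"
  shows "(\<Sum>S\<in>spot_sets a b M. park_weight p M S * H S)
    = (\<Sum>k\<le>M. real (M choose k) * (full_count k * h k) * park_count (M - k) (b - a - k - 1))"
  unfolding sum_by_last_gap[OF assms(1)]
proof (rule sum.cong[OF refl])
  fix k assume k: "k \<in> {..M}"
  have "park_weight p M (S \<union> {b - k<..b}) * H (S \<union> {b - k<..b})
      = real (M choose k) * (full_count k * h k) * park_weight p (M - k) S"
    if "S \<in> spot_sets a (b - k - 1) (M - k)" for S
  proof -
    have "S \<subseteq> {a<..<b - k}" using spot_setsD[OF that] assms(1) k by fastforce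
    then show ?thesis using park_weight_tail[OF assms(1) _ that] assms(2) k by simp
  qed
  then have "(\<Sum>S\<in>spot_sets a (b - k - 1) (M - k).
        park_weight p M (S \<union> {b - k<..b}) * H (S \<union> {b - k<..b}))
      = real (M choose k) * (full_count k * h k)
          * (\<Sum>S\<in>spot_sets a (b - k - 1) (M - k). park_weight p (M - k) S)"
    by (simp add: sum_distrib_left)
  moreover have "b - k - 1 - a = b - a - k - 1" by simp
  ultimately show "(\<Sum>S\<in>spot_sets a (b - k - 1) (M - k).
        park_weight p M (S \<union> {b - k<..b}) * H (S \<union> {b - k<..b}))
      = real (M choose k) * (full_count k * h k) * park_count (M - k) (b - a - k - 1)"
    using sum_park_weight[of "M - k" "b - k - 1" a p] assms(1) k by simp
qed

lemma sum_park_weight_head: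
  assumes "M < b - a"
    and "\<And>k S. k \<le> M \<Longrightarrow> S \<subseteq> {a + k + 1<..b} \<Longrightarrow> H ({a<..a + k} \<union> S) = h k"
  shows "(\<Sum>S\<in>spot_sets a b M. park_weight p M S * H S)
    = (\<Sum>k\<le>M. real (M choose k) * (full_count k * h k) * park_count (M - k) (b - a - k - 1))"
  unfolding sum_by_first_gap[OF assms(1)]
proof (rule sum.cong[OF refl])
  fix k assume k: "k \<in> {..M}"
  have "park_weight p M ({a<..a + k} \<union> S) * H ({a<..a + k} \<union> S)
      = real (M choose k) * (full_count k * h k) * park_weight p (M - k) S"
    if "S \<in> spot_sets (a + k + 1) b (M - k)" for S
    using spot_setsD[OF that] park_weight_head[OF assms(1) _ that] assms(2) k by simp
  then have "(\<Sum>S\<in>spot_sets (a + k + 1) b (M - k).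
        park_weight p M ({a<..a + k} \<union> S) * H ({a<..a + k} \<union> S))
      = real (M choose k) * (full_count k * h k)
          * (\<Sum>S\<in>spot_sets (a + k + 1) b (M - k). park_weight p (M - k) S)"
    by (simp add: sum_distrib_left)
  moreover have "b - (a + k + 1) = b - a - k - 1" by simp
  ultimately show "(\<Sum>S\<in>spot_sets (a + k + 1) b (M - k).
        park_weight p M ({a<..a + k} \<union> S) * H ({a<..a + k} \<union> S))
      = real (M choose k) * (full_count k * h k) * park_count (M - k) (b - a - k - 1)"
    using sum_park_weight[of "M - k" b "a + k + 1" p] assms(1) k by simp
qed

section \<open>From the parking process to the weights\<close>

definition occupied :: "nat option list \<Rightarrow> nat set" where
  "occupied ss = {s. Some s \<in> set ss}"

lemma occupied_Cons: "occupied (s # ss) = set_option s \<union> occupied ss"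
  unfolding occupied_def by (cases s) auto

lemma occupied_snoc: "occupied (ss @ [s]) = set_option s \<union> occupied ss"
  unfolding occupied_def by (cases s) auto

text \<open>
The process is defined from the first car on, whereas the weights are computed from the last car
backwards.
\<close>

lemma park_cars_snoc:
  "park_cars p n A (as @ [b]) = bind_pmf (park_cars p n A as)
     (\<lambda>ss. map_pmf (\<lambda>s. ss @ [s]) (park_car p n (A \<union> occupied ss) b))"
proof (induction as arbitrary: A)
  case Nil
  then show ?case by (simp add: bind_return_pmf occupied_def map_pmf_def)
next
  case (Cons a as)
  then show ?case
    by (simp add: map_bind_pmf bind_map_pmf bind_assoc_pmf pmf.map_comp o_def occupied_Cons Un_assoc)
qed

lemma finite_set_park_car: "finite (set_pmf (park_car p n A a))"
  by (simp add: park_car_def)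

lemma finite_set_park_cars: "finite (set_pmf (park_cars p n A as))"
  by (induction as arbitrary: A) (simp_all add: finite_set_park_car)

text \<open>
The expectation of \<open>\<phi>\<close> of the final set of occupied spots, on the event that all cars park. Keeping
\<open>\<phi>\<close> arbitrary lets the last car be absorbed into \<open>\<phi>\<close>, as \<open>success_expectation_snoc\<close> does.
\<close>

definition success_expectation :: "real \<Rightarrow> nat \<Rightarrow> (nat set \<Rightarrow> real) \<Rightarrow> nat list \<Rightarrow> real" where
  "success_expectation p n \<phi> \<alpha> = measure_pmf.expectation (park_cars p n {} \<alpha>)
     (\<lambda>ss. if None \<in> set ss then 0 else \<phi> (occupied ss))"

definition park_step :: "real \<Rightarrow> nat \<Rightarrow> (nat set \<Rightarrow> real) \<Rightarrow> nat \<Rightarrow> nat set \<Rightarrow> real" where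
  "park_step p n \<phi> b S = measure_pmf.expectation (park_car p n S b)
     (\<lambda>s. case s of None \<Rightarrow> 0 | Some s \<Rightarrow> \<phi> (insert s S))"

lemma success_expectation_snoc: "success_expectation p n \<phi> (\<alpha> @ [b]) = success_expectation p n (park_step p n \<phi> b) \<alpha>"
proof -
  let ?P = "park_cars p n {} \<alpha>"
  let ?h = "\<lambda>ss. if None \<in> set ss then 0 else \<phi> (occupied ss)"
  have "success_expectation p n \<phi> (\<alpha> @ [b]) = (\<Sum>ss\<in>set_pmf ?P. pmf ?P ss
      *\<^sub>R measure_pmf.expectation (map_pmf (\<lambda>s. ss @ [s]) (park_car p n ({} \<union> occupied ss) b)) ?h)"
    unfolding success_expectation_def park_cars_snoc
    by (rule pmf_expectation_bind) (simp_all add: finite_set_park_cars finite_set_park_car)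
  also have "\<dots> = (\<Sum>ss\<in>set_pmf ?P. pmf ?P ss
      *\<^sub>R (if None \<in> set ss then 0 else park_step p n \<phi> b (occupied ss)))"
  proof (rule sum.cong[OF refl])
    fix ss
    have "measure_pmf.expectation (park_car p n (occupied ss) b) (\<lambda>s. ?h (ss @ [s]))
        = (if None \<in> set ss then 0 else park_step p n \<phi> b (occupied ss))"
      unfolding park_step_def
      by (auto simp: occupied_snoc intro!: Bochner_Integration.integral_cong split: option.split)
    then show "pmf ?P ss *\<^sub>R measure_pmf.expectation
          (map_pmf (\<lambda>s. ss @ [s]) (park_car p n ({} \<union> occupied ss) b)) ?h
        = pmf ?P ss *\<^sub>R (if None \<in> set ss then 0 else park_step p n \<phi> b (occupied ss))"
      by simp
  qed
  also have "\<dots> = success_expectation p n (park_step p n \<phi> b) \<alpha>"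
    unfolding success_expectation_def
    by (rule integral_measure_pmf[symmetric]) (simp_all add: finite_set_park_cars)
  finally show ?thesis .
qed

lemma success_expectation_mult: "success_expectation p n (\<lambda>S. c * \<phi> S) \<alpha> = c * success_expectation p n \<phi> \<alpha>"
proof -
  have "(\<lambda>ss. if None \<in> set ss then 0 else c * \<phi> (occupied ss))
      = (\<lambda>ss. c * (if None \<in> set ss then 0 else \<phi> (occupied ss)))"
    by auto
  then show ?thesis unfolding success_expectation_def by simp
qed

lemma sum_preference_lists_Suc:
  "(\<Sum>\<alpha>\<in>preference_lists (Suc k) n. F \<alpha>)
    = (\<Sum>\<alpha>\<in>preference_lists k n. \<Sum>b\<in>{0<..n}. F (\<alpha> @ [b]))"
proof -
  have "bij_betw (\<lambda>(\<alpha>, b). \<alpha> @ [b]) (preference_lists k n \<times> {0<..n}) (preference_lists (Suc k) n)"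
    unfolding bij_betw_def
  proof
    show "inj_on (\<lambda>(\<alpha>, b). \<alpha> @ [b]) (preference_lists k n \<times> {0<..n})"
      by (auto simp: inj_on_def)
    have "\<beta> \<in> (\<lambda>(\<alpha>, b). \<alpha> @ [b]) ` (preference_lists k n \<times> {0<..n})"
      if \<beta>: "\<beta> \<in> preference_lists (Suc k) n" for \<beta>
    proof -
      obtain \<alpha> b where "\<beta> = \<alpha> @ [b]"
        using \<beta> by (cases \<beta> rule: rev_cases) (auto simp: preference_lists_def)
      then show ?thesis using \<beta>
        by (intro image_eqI[of _ _ "(\<alpha>, b)"]) (auto simp: preference_lists_def)
    qed
    moreover have "\<alpha> @ [b] \<in> preference_lists (Suc k) n"
      if "\<alpha> \<in> preference_lists k n" "b \<in> {0<..n}" for \<alpha> b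
      using that by (simp add: preference_lists_def)
    ultimately show
      "(\<lambda>(\<alpha>, b). \<alpha> @ [b]) ` (preference_lists k n \<times> {0<..n}) = preference_lists (Suc k) n"
      by auto
  qed
  then have "(\<Sum>\<alpha>\<in>preference_lists (Suc k) n. F \<alpha>)
      = (\<Sum>(\<alpha>, b)\<in>preference_lists k n \<times> {0<..n}. F (\<alpha> @ [b]))"
    by (subst sum.reindex_bij_betw[symmetric]) (auto simp: case_prod_unfold)
  then show ?thesis by (simp add: sum.cartesian_product)
qed

lemma park_step_eq:
  assumes "0 \<le> p" "p \<le> 1"
  shows "park_step p n \<phi> b S = (if b \<notin> S then \<phi> (insert b S) else
      p * (case forward_spot n S b of None \<Rightarrow> 0 | Some s \<Rightarrow> \<phi> (insert s S))
    + (1 - p) * (case backward_spot S b of None \<Rightarrow> 0 | Some s \<Rightarrow> \<phi> (insert s S)))"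
  unfolding park_step_def park_car_def using assms by simp

text \<open>
Exactly one free spot \<open>s\<close> has the property that it lies beyond \<open>b\<close> and all spots from \<open>b\<close> to
just before \<open>s\<close> are occupied, unless there is no free spot ahead. Written as a sum over
\<open>s\<close>, the outcome for a fixed preference \<open>b\<close> can be exchanged with the sum over \<open>b\<close>.
\<close>

lemma case_forward_spot:
  assumes "b \<in> S"
  shows "(case forward_spot n S b of None \<Rightarrow> 0 | Some s \<Rightarrow> \<psi> s)
    = (\<Sum>s\<in>{0<..n} - S. if b < s \<and> {b..<s} \<subseteq> S then \<psi> s else (0::real))"
proof (cases "{b<..n} - S = {}")
  case True
  have "\<not> b < s" if "s \<in> {0<..n} - S" for s
    using that True by (metis DiffD1 DiffD2 DiffI empty_iff greaterThanAtMost_iff)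
  then have "(\<Sum>s\<in>{0<..n} - S. if b < s \<and> {b..<s} \<subseteq> S then \<psi> s else 0) = 0"
    by (intro sum.neutral) auto
  then show ?thesis using True by (simp add: forward_spot_def)
next
  case False
  define g where "g = Min ({b<..n} - S)"
  have g: "g \<in> {b<..n} - S" unfolding g_def using False by (intro Min_in) auto
  have "b < s \<and> {b..<s} \<subseteq> S \<longleftrightarrow> s = g" if s: "s \<in> {0<..n} - S" for s
  proof
    assume c: "b < s \<and> {b..<s} \<subseteq> S"
    then have "g \<le> s" unfolding g_def using s by (intro Min_le) auto
    moreover have "\<not> g < s"
    proof
      assume "g < s"
      then have "g \<in> {b..<s}" using g by auto
      then show False using c g by blast
    qed
    ultimately show "s = g" by simp
  next
    assume "s = g"
    have "x \<in> S" if x: "x \<in> {b..<g}" for x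
    proof (rule ccontr)
      assume "x \<notin> S"
      then have "x \<noteq> b" using assms by auto
      then have "g \<le> x" unfolding g_def using x \<open>x \<notin> S\<close> g by (intro Min_le) auto
      then show False using x by simp
    qed
    then show "b < s \<and> {b..<s} \<subseteq> S" using \<open>s = g\<close> g by auto
  qed
  then have "(\<Sum>s\<in>{0<..n} - S. if b < s \<and> {b..<s} \<subseteq> S then \<psi> s else 0)
      = (\<Sum>s\<in>{0<..n} - S. if s = g then \<psi> s else 0)"
    by (intro sum.cong) auto
  also have "\<dots> = \<psi> g" using g by (subst sum.delta) auto
  finally show ?thesis using False unfolding forward_spot_def g_def by simp
qed

lemma case_backward_spot:
  assumes "b \<in> S" "b \<le> n"
  shows "(case backward_spot S b of None \<Rightarrow> 0 | Some s \<Rightarrow> \<psi> s)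
    = (\<Sum>s\<in>{0<..n} - S. if s < b \<and> {s<..b} \<subseteq> S then \<psi> s else (0::real))"
proof (cases "{1..<b} - S = {}")
  case True
  have "\<not> s < b" if s: "s \<in> {0<..n} - S" for s
  proof
    assume "s < b"
    then have "s \<in> {1..<b} - S" using s by auto
    then show False using True by blast
  qed
  then have "(\<Sum>s\<in>{0<..n} - S. if s < b \<and> {s<..b} \<subseteq> S then \<psi> s else 0) = 0"
    by (intro sum.neutral) auto
  then show ?thesis using True by (simp add: backward_spot_def)
next
  case False
  define g where "g = Max ({1..<b} - S)"
  have g: "g \<in> {1..<b} - S" unfolding g_def using False by (intro Max_in) auto
  have "s < b \<and> {s<..b} \<subseteq> S \<longleftrightarrow> s = g" if s: "s \<in> {0<..n} - S" for s
  proof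
    assume c: "s < b \<and> {s<..b} \<subseteq> S"
    then have "s \<le> g" unfolding g_def using s by (intro Max_ge) auto
    moreover have "\<not> s < g"
    proof
      assume "s < g"
      then have "g \<in> {s<..b}" using g by auto
      then show False using c g by blast
    qed
    ultimately show "s = g" by simp
  next
    assume "s = g"
    have "x \<in> S" if x: "x \<in> {g<..b}" for x
    proof (rule ccontr)
      assume "x \<notin> S"
      then have "x \<noteq> b" using assms by auto
      then have "x \<le> g" unfolding g_def using x \<open>x \<notin> S\<close> g by (intro Max_ge) auto
      then show False using x by simp
    qed
    then show "s < b \<and> {s<..b} \<subseteq> S" using \<open>s = g\<close> g by auto
  qed
  then have "(\<Sum>s\<in>{0<..n} - S. if s < b \<and> {s<..b} \<subseteq> S then \<psi> s else 0)
      = (\<Sum>s\<in>{0<..n} - S. if s = g then \<psi> s else 0)"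
    by (intro sum.cong) auto
  also have "\<dots> = \<psi> g" using g assms by (subst sum.delta) auto
  finally show ?thesis using False unfolding backward_spot_def g_def by simp
qed

lemma sum_if_card:
  assumes "finite S" "{b. P b} \<subseteq> S"
  shows "(\<Sum>b\<in>S. if P b then c else 0) = real (card {b. P b}) * (c::real)"
proof -
  have "{b \<in> S. P b} = {b. P b}" using assms(2) by auto
  then show ?thesis using assms(1) by (simp add: sum.If_cases Int_def)
qed

text \<open>
The runs next to \<open>s\<close> do not contain \<open>s\<close>, so they may be computed before the car parks.
\<close>

lemma spot_rate_insert:
  "spot_rate p (insert s S) s = 1 + p * real (card {b. b < s \<and> {b..<s} \<subseteq> S})
    + (1 - p) * real (card {b. s < b \<and> {s<..b} \<subseteq> S})"
proof -
  have "{b..<s} \<subseteq> insert s S \<longleftrightarrow> {b..<s} \<subseteq> S" "{s<..b} \<subseteq> insert s S \<longleftrightarrow> {s<..b} \<subseteq> S" for b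
    by auto
  then show ?thesis by (simp add: spot_rate_def left_run_def right_run_def)
qed

text \<open>
Double counting of the pairs of a preference and a resulting spot: summed by spot, the preferences
are those counted by \<^const>\<open>spot_rate\<close>.
\<close>

lemma sum_park_step:
  assumes p: "0 \<le> p" "p \<le> 1" and S: "S \<subseteq> {0<..n}"
  shows "(\<Sum>b\<in>{0<..n}. park_step p n \<phi> b S)
    = (\<Sum>s\<in>{0<..n} - S. spot_rate p (insert s S) s * \<phi> (insert s S))"
proof -
  let ?\<psi> = "\<lambda>s. \<phi> (insert s S)"
  let ?F = "{0<..n} - S"
  let ?l = "\<lambda>s. card {b. b < s \<and> {b..<s} \<subseteq> S}" and ?r = "\<lambda>s. card {b. s < b \<and> {s<..b} \<subseteq> S}"
  have fin: "finite S" using S finite_subset by auto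
  have "(\<Sum>b\<in>{0<..n}. park_step p n \<phi> b S)
      = (\<Sum>b\<in>?F. park_step p n \<phi> b S) + (\<Sum>b\<in>S. park_step p n \<phi> b S)"
    using S by (intro sum.subset_diff) auto
  also have "(\<Sum>b\<in>?F. park_step p n \<phi> b S) = (\<Sum>s\<in>?F. ?\<psi> s)"
    by (intro sum.cong) (auto simp: park_step_eq[OF p])
  also have "(\<Sum>b\<in>S. park_step p n \<phi> b S)
      = (\<Sum>b\<in>S. p * (\<Sum>s\<in>?F. if b < s \<and> {b..<s} \<subseteq> S then ?\<psi> s else 0)
          + (1 - p) * (\<Sum>s\<in>?F. if s < b \<and> {s<..b} \<subseteq> S then ?\<psi> s else 0))"
  proof (rule sum.cong[OF refl])
    fix b assume b: "b \<in> S"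
    then have "b \<le> n" using S by auto
    then show "park_step p n \<phi> b S = p * (\<Sum>s\<in>?F. if b < s \<and> {b..<s} \<subseteq> S then ?\<psi> s else 0)
          + (1 - p) * (\<Sum>s\<in>?F. if s < b \<and> {s<..b} \<subseteq> S then ?\<psi> s else 0)"
      unfolding park_step_eq[OF p] using b case_forward_spot[where S = S and \<psi> = ?\<psi>] case_backward_spot[where S = S and \<psi> = ?\<psi>]
      by simp
  qed
  also have "\<dots> = p * (\<Sum>s\<in>?F. \<Sum>b\<in>S. if b < s \<and> {b..<s} \<subseteq> S then ?\<psi> s else 0)
          + (1 - p) * (\<Sum>s\<in>?F. \<Sum>b\<in>S. if s < b \<and> {s<..b} \<subseteq> S then ?\<psi> s else 0)"
    unfolding sum.distrib sum_distrib_left[symmetric] sum.swap[of _ ?F S] ..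
  also have "(\<Sum>s\<in>?F. \<Sum>b\<in>S. if b < s \<and> {b..<s} \<subseteq> S then ?\<psi> s else 0)
      = (\<Sum>s\<in>?F. real (?l s) * ?\<psi> s)"
    using fin by (intro sum.cong refl sum_if_card) (auto simp: subset_iff)
  also have "(\<Sum>s\<in>?F. \<Sum>b\<in>S. if s < b \<and> {s<..b} \<subseteq> S then ?\<psi> s else 0)
      = (\<Sum>s\<in>?F. real (?r s) * ?\<psi> s)"
    using fin by (intro sum.cong refl sum_if_card) (auto simp: subset_iff)
  finally show ?thesis
    unfolding spot_rate_insert by (simp add: algebra_simps sum.distrib sum_distrib_left sum_subtractf)
qed

lemma sum_insert_spot:
  "(\<Sum>S\<in>spot_sets 0 n k. \<Sum>s\<in>{0<..n} - S. f s (insert s S) S)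
    = (\<Sum>S\<in>spot_sets 0 n (Suc k). \<Sum>s\<in>S. f s S (S - {s}))"
proof -
  have "(\<Sum>(S, s)\<in>(SIGMA S:spot_sets 0 n k. {0<..n} - S). f s (insert s S) S)
      = (\<Sum>(S, s)\<in>(SIGMA S:spot_sets 0 n (Suc k). S). f s S (S - {s}))"
    by (rule sum.reindex_bij_witness[where i = "\<lambda>(S, s). (S - {s}, s)" and j = "\<lambda>(S, s). (insert s S, s)"])
      (auto simp: insert_absorb dest: spot_setsD, auto simp: spot_sets_def card_insert_if finite_subset)
  then show ?thesis
    by (subst (asm) (1 2) sum.Sigma[symmetric]) (auto simp: finite_spot_sets dest: spot_setsD)
qed

text \<open>
Induction on the number of cars: the last car is moved into \<open>\<phi>\<close>, its preference is summed out by
\<open>sum_park_step\<close>, and the recursion of \<^const>\<open>park_weight\<close> reappears after exchanging the sums over the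
old set and the new spot for those over the new set and its last spot.
\<close>

lemma sum_success_expectation:
  assumes p: "0 \<le> p" "p \<le> 1"
  shows "(\<Sum>\<alpha>\<in>preference_lists k n. success_expectation p n \<phi> \<alpha>)
    = (\<Sum>S\<in>spot_sets 0 n k. park_weight p k S * \<phi> S)"
proof (induction k arbitrary: \<phi>)
  case 0
  have "preference_lists 0 n = {[]}" by (auto simp: preference_lists_def)
  moreover have "spot_sets 0 n 0 = {{}}"
    by (auto simp: spot_sets_def finite_subset[OF _ finite_greaterThanAtMost])
  ultimately show ?case by (simp add: success_expectation_def occupied_def)
next
  case (Suc k)
  have "(\<Sum>\<alpha>\<in>preference_lists (Suc k) n. success_expectation p n \<phi> \<alpha>)
      = (\<Sum>b\<in>{0<..n}. \<Sum>\<alpha>\<in>preference_lists k n. success_expectation p n (park_step p n \<phi> b) \<alpha>)"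
    unfolding sum_preference_lists_Suc success_expectation_snoc by (rule sum.swap)
  also have "\<dots> = (\<Sum>b\<in>{0<..n}. \<Sum>S\<in>spot_sets 0 n k. park_weight p k S * park_step p n \<phi> b S)"
    by (simp add: Suc.IH)
  also have "\<dots> = (\<Sum>S\<in>spot_sets 0 n k. park_weight p k S * (\<Sum>b\<in>{0<..n}. park_step p n \<phi> b S))"
    unfolding sum_distrib_left by (rule sum.swap)
  also have "\<dots> = (\<Sum>S\<in>spot_sets 0 n k. \<Sum>s\<in>{0<..n} - S.
      park_weight p k S * (spot_rate p (insert s S) s * \<phi> (insert s S)))"
  proof (rule sum.cong[OF refl])
    fix S assume "S \<in> spot_sets 0 n k"
    then have "S \<subseteq> {0<..n}" by (auto dest: spot_setsD)
    then show "park_weight p k S * (\<Sum>b\<in>{0<..n}. park_step p n \<phi> b S)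
      = (\<Sum>s\<in>{0<..n} - S. park_weight p k S * (spot_rate p (insert s S) s * \<phi> (insert s S)))"
      by (simp only: sum_park_step[OF p] sum_distrib_left)
  qed
  also have "\<dots> = (\<Sum>S\<in>spot_sets 0 n (Suc k). \<Sum>s\<in>S.
      park_weight p k (S - {s}) * (spot_rate p S s * \<phi> S))"
    by (rule sum_insert_spot)
  also have "\<dots> = (\<Sum>S\<in>spot_sets 0 n (Suc k). park_weight p (Suc k) S * \<phi> S)"
    by (simp add: sum_distrib_right mult.assoc)
  finally show ?case .
qed

text \<open>
With \<open>\<phi> = 1\<close> a step is the probability of parking. A failure needs an occupied preference and no free
spot in the chosen direction.
\<close>

lemma sum_park_step_one:
  assumes p: "0 \<le> p" "p \<le> 1" and S: "S \<subseteq> {0<..n}"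
  shows "(\<Sum>b\<in>{0<..n}. h b * park_step p n (\<lambda>_. 1) b S)
    = (\<Sum>b\<in>{0<..n}. h b) - p * (\<Sum>b\<in>{b \<in> {0<..n}. {b..n} \<subseteq> S}. h b)
      - (1 - p) * (\<Sum>b\<in>{b \<in> {0<..n}. {0<..b} \<subseteq> S}. h b)"
proof -
  have "h b * park_step p n (\<lambda>_. 1) b S
      = h b - p * (if {b..n} \<subseteq> S then h b else 0) - (1 - p) * (if {0<..b} \<subseteq> S then h b else 0)"
    if b: "b \<in> {0<..n}" for b
  proof (cases "b \<in> S")
    case False
    moreover have "b \<in> {b..n}" "b \<in> {0<..b}" using b by auto
    ultimately have "\<not> {b..n} \<subseteq> S" "\<not> {0<..b} \<subseteq> S" by blast+
    then show ?thesis using False by (simp add: park_step_eq[OF p])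
  next
    case True
    have "{b..n} = insert b {b<..n}" "{0<..b} = insert b {1..<b}" using b by auto
    then have "{b<..n} - S = {} \<longleftrightarrow> {b..n} \<subseteq> S" "{1..<b} - S = {} \<longleftrightarrow> {0<..b} \<subseteq> S"
      using True by auto
    then show ?thesis using True
      by (simp add: park_step_eq[OF p] forward_spot_def backward_spot_def algebra_simps)
  qed
  then have "(\<Sum>b\<in>{0<..n}. h b * park_step p n (\<lambda>_. 1) b S)
      = (\<Sum>b\<in>{0<..n}. h b - p * (if {b..n} \<subseteq> S then h b else 0)
          - (1 - p) * (if {0<..b} \<subseteq> S then h b else 0))"
    by (intro sum.cong) auto
  then show ?thesis
    unfolding sum_subtractf sum_distrib_left[symmetric] sum.inter_filter[OF finite_greaterThanAtMost] .
qed

lemma sum_last_preference_by_occupied_set: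
  assumes p: "0 \<le> p" "p \<le> 1"
  shows "(\<Sum>\<alpha>\<in>preference_lists (Suc M) n. h (\<alpha> ! M) * success_expectation p n (\<lambda>_. 1) \<alpha>)
    = (\<Sum>S\<in>spot_sets 0 n M. park_weight p M S *
        ((\<Sum>b\<in>{0<..n}. h b) - p * (\<Sum>b\<in>{b \<in> {0<..n}. {b..n} \<subseteq> S}. h b)
          - (1 - p) * (\<Sum>b\<in>{b \<in> {0<..n}. {0<..b} \<subseteq> S}. h b)))"
proof -
  have nth: "(\<alpha> @ [b]) ! M = b" if "\<alpha> \<in> preference_lists M n" for \<alpha> and b :: nat
    using that by (auto simp: preference_lists_def)
  have "(\<Sum>\<alpha>\<in>preference_lists (Suc M) n. h (\<alpha> ! M) * success_expectation p n (\<lambda>_. 1) \<alpha>)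
      = (\<Sum>\<alpha>\<in>preference_lists M n. \<Sum>b\<in>{0<..n}. success_expectation p n (\<lambda>S. h b * park_step p n (\<lambda>_. 1) b S) \<alpha>)"
    unfolding sum_preference_lists_Suc by (simp add: nth success_expectation_snoc success_expectation_mult)
  also have "\<dots> = (\<Sum>b\<in>{0<..n}. \<Sum>S\<in>spot_sets 0 n M. park_weight p M S * (h b * park_step p n (\<lambda>_. 1) b S))"
    unfolding sum_success_expectation[OF p, symmetric] by (rule sum.swap)
  also have "\<dots> = (\<Sum>S\<in>spot_sets 0 n M. park_weight p M S * (\<Sum>b\<in>{0<..n}. h b * park_step p n (\<lambda>_. 1) b S))"
    unfolding sum_distrib_left by (rule sum.swap)
  also have "\<dots> = (\<Sum>S\<in>spot_sets 0 n M. park_weight p M S *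
        ((\<Sum>b\<in>{0<..n}. h b) - p * (\<Sum>b\<in>{b \<in> {0<..n}. {b..n} \<subseteq> S}. h b)
          - (1 - p) * (\<Sum>b\<in>{b \<in> {0<..n}. {0<..b} \<subseteq> S}. h b)))"
  proof (rule sum.cong[OF refl])
    fix S assume "S \<in> spot_sets 0 n M"
    then have "S \<subseteq> {0<..n}" by (auto dest: spot_setsD)
    then show "park_weight p M S * (\<Sum>b\<in>{0<..n}. h b * park_step p n (\<lambda>_. 1) b S)
      = park_weight p M S * ((\<Sum>b\<in>{0<..n}. h b) - p * (\<Sum>b\<in>{b \<in> {0<..n}. {b..n} \<subseteq> S}. h b)
          - (1 - p) * (\<Sum>b\<in>{b \<in> {0<..n}. {0<..b} \<subseteq> S}. h b))"
      by (simp only: sum_park_step_one[OF p])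
  qed
  finally show ?thesis .
qed

section \<open>The conditional expectation of the last preference\<close>

lemma expectation_cond_pmf:
  fixes f :: "'a \<Rightarrow> real"
  assumes "finite (set_pmf P)" "set_pmf P \<inter> A \<noteq> {}"
  shows "measure_pmf.expectation (cond_pmf P A) f
    = measure_pmf.expectation P (\<lambda>x. if x \<in> A then f x else 0) / measure_pmf.prob P A"
proof -
  have "measure_pmf.expectation (cond_pmf P A) f
      = (\<Sum>x\<in>set_pmf P. pmf (cond_pmf P A) x *\<^sub>R f x)"
    by (rule integral_measure_pmf) (use assms in auto)
  also have "\<dots> = (\<Sum>x\<in>set_pmf P. pmf P x *\<^sub>R (if x \<in> A then f x else 0)) / measure_pmf.prob P A"
    unfolding sum_divide_distrib by (intro sum.cong) (auto simp: pmf_cond[OF assms(2)])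
  also have "(\<Sum>x\<in>set_pmf P. pmf P x *\<^sub>R (if x \<in> A then f x else 0))
      = measure_pmf.expectation P (\<lambda>x. if x \<in> A then f x else 0)"
    by (rule integral_measure_pmf[symmetric]) (use assms in auto)
  finally show ?thesis .
qed

lemma expectation_all_parked:
  assumes "1 \<le> n"
  shows "measure_pmf.expectation (parking_pmf p m n) (\<lambda>x. if x \<in> all_parked then h (fst x) else 0)
    = (\<Sum>\<alpha>\<in>preference_lists m n. h \<alpha> * success_expectation p n (\<lambda>_. 1) \<alpha>) / real (card (preference_lists m n))"
proof -
  let ?L = "preference_lists m n"
  have ne: "?L \<noteq> {}"
    using assms by (auto simp: preference_lists_def intro!: exI[of _ "replicate m 1"])
  have "measure_pmf.expectation (parking_pmf p m n) (\<lambda>x. if x \<in> all_parked then h (fst x) else 0)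
      = (\<Sum>\<alpha>\<in>?L. pmf (pmf_of_set ?L) \<alpha> *\<^sub>R measure_pmf.expectation
          (map_pmf (\<lambda>ss. (\<alpha>, ss)) (park_cars p n {} \<alpha>)) (\<lambda>x. if x \<in> all_parked then h (fst x) else 0))"
    unfolding parking_pmf_def
    by (rule pmf_expectation_bind)
      (auto simp: finite_preference_lists finite_set_park_cars set_pmf_of_set[OF ne])
  also have "\<dots> = (\<Sum>\<alpha>\<in>?L. h \<alpha> * success_expectation p n (\<lambda>_. 1) \<alpha> / real (card ?L))"
  proof (rule sum.cong[OF refl])
    fix \<alpha> assume "\<alpha> \<in> ?L"
    have "measure_pmf.expectation (park_cars p n {} \<alpha>) (\<lambda>ss. if (\<alpha>, ss) \<in> all_parked then h (fst (\<alpha>, ss)) else 0)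
        = success_expectation p n (\<lambda>_. h \<alpha> * 1) \<alpha>"
      unfolding success_expectation_def all_parked_def by (intro Bochner_Integration.integral_cong) auto
    then show "pmf (pmf_of_set ?L) \<alpha> *\<^sub>R measure_pmf.expectation
          (map_pmf (\<lambda>ss. (\<alpha>, ss)) (park_cars p n {} \<alpha>)) (\<lambda>x. if x \<in> all_parked then h (fst x) else 0)
        = h \<alpha> * success_expectation p n (\<lambda>_. 1) \<alpha> / real (card ?L)"
      using \<open>\<alpha> \<in> ?L\<close> unfolding success_expectation_mult
      by (simp add: pmf_of_set[OF ne finite_preference_lists])
  qed
  finally show ?thesis by (simp add: sum_divide_distrib)
qed

lemma finite_set_parking_pmf: "1 \<le> n \<Longrightarrow> finite (set_pmf (parking_pmf p m n))"
proof -
  assume n: "1 \<le> n"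
  then have "preference_lists m n \<noteq> {}"
    by (auto simp: preference_lists_def intro!: exI[of _ "replicate m 1"])
  then show ?thesis
    by (simp add: parking_pmf_def set_pmf_of_set finite_preference_lists finite_set_park_cars)
qed

lemma tail_block:
  fixes g n :: nat
  assumes "S \<subseteq> {0<..<g}" "g \<le> n"
  shows "{b \<in> {0<..n}. {b..n} \<subseteq> S \<union> {g<..n}} = {g<..n}"
proof (intro subset_antisym subsetI)
  fix b assume b: "b \<in> {b \<in> {0<..n}. {b..n} \<subseteq> S \<union> {g<..n}}"
  have "g \<notin> S \<union> {g<..n}" using assms(1) by auto
  then have "g \<notin> {b..n}" using b by blast
  then show "b \<in> {g<..n}" using b assms(2) by auto
qed auto

lemma head_block:
  fixes k n :: nat
  assumes "S \<subseteq> {k + 1<..n}" "k \<le> n"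
  shows "{b \<in> {0<..n}. {0<..b} \<subseteq> {0<..k} \<union> S} = {0<..k}"
proof (intro subset_antisym subsetI)
  fix b assume b: "b \<in> {b \<in> {0<..n}. {0<..b} \<subseteq> {0<..k} \<union> S}"
  have "k + 1 \<notin> {0<..k} \<union> S" using assms(1) by auto
  then have "k + 1 \<notin> {0<..b}" using b by blast
  then show "b \<in> {0<..k}" using b by auto
qed (use assms(2) in auto)

text \<open>
Both \<open>h = 1\<close> (the normalisation) and \<open>h b = b\<close> (the numerator of the expectation) are needed below.
\<close>

lemma sum_last_preference_by_run:
  assumes p: "0 \<le> p" "p \<le> 1" and M: "M < n"
  shows "(\<Sum>\<alpha>\<in>preference_lists (Suc M) n. h (\<alpha> ! M) * success_expectation p n (\<lambda>_. 1) \<alpha>)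
    = (\<Sum>b\<in>{0<..n}. h b) * park_count M n
      - p * (\<Sum>k\<le>M. real (M choose k) * (full_count k * (\<Sum>b\<in>{n - k<..n}. h b)) * park_count (M - k) (n - k - 1))
      - (1 - p) * (\<Sum>k\<le>M. real (M choose k) * (full_count k * (\<Sum>b\<in>{0<..k}. h b)) * park_count (M - k) (n - k - 1))"
proof -
  have M0: "M < n - 0" using M by simp
  let ?T = "\<lambda>S. \<Sum>b\<in>{b \<in> {0<..n}. {b..n} \<subseteq> S}. h b"
  let ?H = "\<lambda>S. \<Sum>b\<in>{b \<in> {0<..n}. {0<..b} \<subseteq> S}. h b"
  let ?c = "\<Sum>b\<in>{0<..n}. h b"
  have "(\<Sum>\<alpha>\<in>preference_lists (Suc M) n. h (\<alpha> ! M) * success_expectation p n (\<lambda>_. 1) \<alpha>)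
      = (\<Sum>S\<in>spot_sets 0 n M. ?c * park_weight p M S - p * (park_weight p M S * ?T S)
          - (1 - p) * (park_weight p M S * ?H S))"
    unfolding sum_last_preference_by_occupied_set[OF p] by (intro sum.cong refl) (simp add: algebra_simps)
  also have "\<dots> = ?c * (\<Sum>S\<in>spot_sets 0 n M. park_weight p M S)
      - p * (\<Sum>S\<in>spot_sets 0 n M. park_weight p M S * ?T S)
      - (1 - p) * (\<Sum>S\<in>spot_sets 0 n M. park_weight p M S * ?H S)"
    by (simp only: sum_subtractf sum_distrib_left)
  also have "(\<Sum>S\<in>spot_sets 0 n M. park_weight p M S) = park_count M n"
    using sum_park_weight[of M n 0 p] M by simp
  also have "(\<Sum>S\<in>spot_sets 0 n M. park_weight p M S * ?T S)
      = (\<Sum>k\<le>M. real (M choose k) * (full_count k * (\<Sum>b\<in>{n - k<..n}. h b)) * park_count (M - k) (n - 0 - k - 1))"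
    by (rule sum_park_weight_tail[OF M0]) (simp only: tail_block diff_le_self)
  also have "(\<Sum>S\<in>spot_sets 0 n M. park_weight p M S * ?H S)
      = (\<Sum>k\<le>M. real (M choose k) * (full_count k * (\<Sum>b\<in>{0<..k}. h b)) * park_count (M - k) (n - 0 - k - 1))"
    by (rule sum_park_weight_head[OF M0]) (use M in \<open>simp only: add_0 head_block\<close>)
  finally show ?thesis by simp
qed

lemma sum_initial: "(\<Sum>b\<in>{0<..k}. real b) = real k * (real k + 1) / 2"
  by (induction k) (simp_all add: atLeastSucAtMost_greaterThanAtMost[symmetric] algebra_simps)

lemma sum_final:
  assumes "k \<le> n"
  shows "(\<Sum>b\<in>{n - k<..n}. real b) = real k * (real n + 1) - real k * (real k + 1) / 2"
proof -
  have "{0<..n} = {0<..n - k} \<union> {n - k<..n}" using assms by auto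
  then have "(\<Sum>b\<in>{0<..n}. real b) = (\<Sum>b\<in>{0<..n - k}. real b) + (\<Sum>b\<in>{n - k<..n}. real b)"
    by (simp add: sum.union_disjoint[symmetric])
  then show ?thesis using assms unfolding sum_initial by (simp add: of_nat_diff field_simps)
qed

lemma total_success_weight:
  assumes p: "0 \<le> p" "p \<le> 1" and M: "M < n"
  shows "(\<Sum>\<alpha>\<in>preference_lists (Suc M) n. success_expectation p n (\<lambda>_. 1) \<alpha>)
    = (real n - real M) * (real n + 1) ^ M"
proof -
  have tail: "(\<Sum>k\<le>M. real (M choose k) * (full_count k * (\<Sum>b\<in>{n - k<..n}. 1)) * park_count (M - k) (n - k - 1))
      = (\<Sum>k\<le>M. real (M choose k) * (full_count k * real k) * park_count (M - k) (n - k - 1))"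
    using M by (intro sum.cong refl) simp
  have head: "(\<Sum>k\<le>M. real (M choose k) * (full_count k * (\<Sum>b\<in>{0<..k}. 1)) * park_count (M - k) (n - k - 1))
      = (\<Sum>k\<le>M. real (M choose k) * (full_count k * real k) * park_count (M - k) (n - k - 1))"
    by simp
  have "(\<Sum>\<alpha>\<in>preference_lists (Suc M) n. success_expectation p n (\<lambda>_. 1) \<alpha>)
      = real n * park_count M n - real M * (real n + 1) ^ (M - 1)"
    using sum_last_preference_by_run[OF assms, of "\<lambda>_. 1"]
    unfolding tail head sum_run_length[OF M] by (simp add: algebra_simps)
  also have "\<dots> = (real n - real M) * (real n + 1) ^ M"
    unfolding park_count_def by (cases M) (simp_all add: algebra_simps)
  finally show ?thesis .
qed

text \<open>
Let \<open>X\<close> and \<open>Y\<close> be the weighted sums of \<open>k\<close> and of \<open>k (k + 1)\<close>. The preferences in the tail add up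
to \<open>(n + 1) X - Y / 2\<close>, those in the head to \<open>Y / 2\<close>, so that \<open>Y\<close> enters with the coefficient
\<open>p - 1 / 2\<close>.
\<close>

lemma total_last_preference:
  assumes p: "0 \<le> p" "p \<le> 1" and M: "M < n"
  shows "(\<Sum>\<alpha>\<in>preference_lists (Suc M) n. real (\<alpha> ! M) * success_expectation p n (\<lambda>_. 1) \<alpha>)
    = (real n - real M) * ((real n + 2 * p) / 2 * (real n + 1) ^ M
        - (p - 1 / 2) * poisson_sum M (real n + 1))"
proof -
  let ?w = "\<lambda>k. park_count (M - k) (n - k - 1)"
  let ?s = "real n + 1"
  define X where "X = (\<Sum>k\<le>M. real (M choose k) * (full_count k * real k) * ?w k)"
  define Y where "Y = (\<Sum>k\<le>M. real (M choose k) * (full_count k * (real k * (real k + 1))) * ?w k)"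
  have tail: "(\<Sum>k\<le>M. real (M choose k) * (full_count k * (\<Sum>b\<in>{n - k<..n}. real b)) * ?w k)
      = ?s * X - Y / 2"
  proof -
    have "(\<Sum>k\<le>M. real (M choose k) * (full_count k * (\<Sum>b\<in>{n - k<..n}. real b)) * ?w k)
        = (\<Sum>k\<le>M. ?s * (real (M choose k) * (full_count k * real k) * ?w k)
            - real (M choose k) * (full_count k * (real k * (real k + 1))) * ?w k / 2)"
      using M by (intro sum.cong refl) (simp add: sum_final field_simps)
    then show ?thesis
      unfolding X_def Y_def sum_subtractf sum_distrib_left sum_divide_distrib .
  qed
  have head: "(\<Sum>k\<le>M. real (M choose k) * (full_count k * (\<Sum>b\<in>{0<..k}. real b)) * ?w k) = Y / 2"
    unfolding Y_def sum_divide_distrib by (intro sum.cong refl) (simp add: sum_initial)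
  have "(\<Sum>\<alpha>\<in>preference_lists (Suc M) n. real (\<alpha> ! M) * success_expectation p n (\<lambda>_. 1) \<alpha>)
      = real n * ?s / 2 * park_count M n - p * (?s * X) + (p - 1 / 2) * Y"
    unfolding sum_last_preference_by_run[OF assms] unfolding tail head unfolding sum_initial by (simp add: field_simps)
  also have "?s * X = real M * ?s ^ M"
    unfolding X_def sum_run_length[OF M] by (cases M) simp_all
  also have "Y = real n * ?s ^ M - (real n - real M) * poisson_sum M ?s"
    unfolding Y_def by (rule sum_run_triangle[OF M])
  also have "real n * ?s / 2 * park_count M n = real n / 2 * (?s - real M) * ?s ^ M"
    unfolding park_count_def by (cases M) (simp_all add: field_simps)
  finally show ?thesis by (simp add: field_simps)
qed

lemma expected_last_preference:
  assumes p: "0 \<le> p" "p \<le> 1" and M: "M < n"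
  shows "measure_pmf.expectation (cond_pmf (parking_pmf p (Suc M) n) all_parked)
      (\<lambda>(\<alpha>, _). real (\<alpha> ! M))
    = (real n + 2 * p) / 2 - (p - 1 / 2) * (poisson_sum M (real n + 1) / (real n + 1) ^ M)"
proof -
  have n: "1 \<le> n" using M by simp
  let ?P = "parking_pmf p (Suc M) n"
  let ?c = "real (card (preference_lists (Suc M) n))"
  have c: "?c > 0"
    using n finite_preference_lists[of "Suc M" n]
    by (auto simp: card_gt_0_iff preference_lists_def intro!: exI[of _ "replicate (Suc M) 1"])
  have "measure_pmf.prob ?P all_parked = measure_pmf.expectation ?P (\<lambda>x. if x \<in> all_parked then 1 else 0)"
  proof -
    have "(\<lambda>x. if x \<in> all_parked then 1 else 0) = (indicator all_parked :: _ \<Rightarrow> real)"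
      by (auto simp: indicator_def)
    then show ?thesis by simp
  qed
  also have "\<dots> = (real n - real M) * (real n + 1) ^ M / ?c"
    using expectation_all_parked[OF n, of p "Suc M" "\<lambda>_. 1"] by (simp add: total_success_weight[OF assms])
  finally have prob: "measure_pmf.prob ?P all_parked = (real n - real M) * (real n + 1) ^ M / ?c" .
  have "measure_pmf.expectation (cond_pmf ?P all_parked) (\<lambda>(\<alpha>, _). real (\<alpha> ! M))
      = measure_pmf.expectation ?P (\<lambda>x. if x \<in> all_parked then real (fst x ! M) else 0)
        / measure_pmf.prob ?P all_parked"
    using expectation_cond_pmf[OF finite_set_parking_pmf[OF n] all_parked_possible, of "Suc M" p "\<lambda>x. real (fst x ! M)"] M
    by (simp add: case_prod_unfold)
  also have "\<dots> = (\<Sum>\<alpha>\<in>preference_lists (Suc M) n. real (\<alpha> ! M) * success_expectation p n (\<lambda>_. 1) \<alpha>)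
      / ((real n - real M) * (real n + 1) ^ M)"
    unfolding prob expectation_all_parked[OF n, of p "Suc M" "\<lambda>\<alpha>. real (\<alpha> ! M)"] using c by simp
  also have "\<dots> = (real n + 2 * p) / 2 - (p - 1 / 2) * (poisson_sum M (real n + 1) / (real n + 1) ^ M)"
    unfolding total_last_preference[OF assms] using M by (simp add: diff_divide_distrib)
  finally show ?thesis .
qed

section \<open>Poisson probabilities and the incomplete gamma function\<close>

lemma prob_poisson_atMost:
  assumes "0 < x"
  shows "measure_pmf.prob (poisson_pmf x) {z. z \<le> M} = (\<Sum>i\<le>M. x ^ i / fact i) * exp (- x)"
proof -
  have "measure_pmf.prob (poisson_pmf x) {z. z \<le> M} = (\<Sum>i\<in>{z. z \<le> M}. pmf (poisson_pmf x) i)"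
    by (rule measure_measure_pmf_finite) simp
  also have "{z. z \<le> M} = {..M}" by auto
  also have "(\<Sum>i\<in>{..M}. pmf (poisson_pmf x) i) = (\<Sum>i\<le>M. x ^ i / fact i * exp (- x))"
    using assms by (intro sum.cong) simp_all
  finally show ?thesis using \<open>{z. z \<le> M} = {..M}\<close> by (simp only: sum_distrib_right)
qed

lemma poisson_sum_eq_prob:
  assumes "0 < x"
  shows "poisson_sum M x = exp x * fact M * measure_pmf.prob (poisson_pmf x) {z. z \<le> M}"
proof -
  have "poisson_sum M x = (\<Sum>i\<le>M. fact M * (x ^ (M - i) / fact (M - i)))"
    unfolding poisson_sum_def
    by (intro sum.cong refl) (simp add: binomial_fact)
  also have "\<dots> = (\<Sum>i\<le>M. fact M * (x ^ i / fact i))"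
    using sum.nat_diff_reindex[of "\<lambda>i. fact M * (x ^ i / fact i)" "Suc M"]
    by (simp only: lessThan_Suc_atMost diff_Suc_Suc)
  finally show ?thesis
    unfolding prob_poisson_atMost[OF assms] by (simp add: sum_distrib_left[symmetric] exp_minus del: times_divide_eq_right)
qed

text \<open>
The integrand is \<open>M!\<close> times an Erlang density of rate \<open>1\<close>, whose distribution function at \<open>x\<close> is one
minus the Poisson probability: the \<open>(M + 1)\<close>-st arrival of a Poisson process comes after time \<open>x\<close> if
and only if at most \<open>M\<close> arrivals have occurred by then.
\<close>

lemma upper_Gamma_eq_prob:
  assumes "0 < x"
  shows "upper_Gamma (real M + 1) x
    = fact M * measure_pmf.prob (poisson_pmf x) {z. z \<le> M}"
proof -
  let ?f = "erlang_density M 1"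
  have nonneg: "0 \<le> ?f t" for t by simp
  have total: "has_bochner_integral lborel ?f 1"
    using nn_integral_erlang_ith_moment[of 1 M 0]
    by (intro has_bochner_integral_nn_integral) (auto simp: nonneg)
  have below: "has_bochner_integral lborel (\<lambda>t. ?f t * indicator {..x} t) (erlang_CDF M 1 x)"
  proof (rule has_bochner_integral_nn_integral)
    have "(\<integral>\<^sup>+ t. ennreal (?f t * indicator {..x} t) \<partial>lborel)
        = (\<integral>\<^sup>+ t. ennreal (?f t) * indicator {..x} t \<partial>lborel)"
      by (intro nn_integral_cong) (auto split: split_indicator)
    then show "(\<integral>\<^sup>+ t. ennreal (?f t * indicator {..x} t) \<partial>lborel) = ennreal (erlang_CDF M 1 x)"
      using nn_integral_erlang_density[of 1 M x] by simp
  qed (auto simp: nonneg)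
  have "upper_Gamma (real M + 1) x
      = (LINT t|lborel. fact M * (?f t - ?f t * indicator {..x} t))"
    unfolding upper_Gamma_def set_lebesgue_integral_def
  proof (rule integral_cong_AE)
    \<comment> \<open>The sets \<open>{x..}\<close> and \<open>- {..x}\<close> differ in the null set \<open>{x}\<close>.\<close>
    show "AE t in lborel. indicator {x..} t *\<^sub>R (t powr (real M + 1 - 1) * exp (- t))
        = fact M * (?f t - ?f t * indicator {..x} t)"
      using AE_lborel_singleton[of x]
    proof eventually_elim
      case (elim t)
      show ?case
        using elim assms by (auto simp: erlang_density_def powr_realpow split: split_indicator)
    qed
  qed measurable
  also have "\<dots> = fact M * (1 - erlang_CDF M 1 x)"
    using has_bochner_integral_integral_eq[OF has_bochner_integral_diff[OF total below]] by simp
  finally show ?thesis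
    using assms by (simp add: prob_poisson_atMost erlang_CDF_def sum_distrib_right)
qed

theorem theorem2p10:
  fixes m n :: nat and p :: real
  assumes "1 \<le> m" and "m \<le> n" and "0 \<le> p" and "p \<le> 1"
  shows "measure_pmf.expectation (cond_pmf (parking_pmf p m n) all_parked)
           (\<lambda>(\<alpha>, _). real (\<alpha> ! (m - 1)))
         = (real n + 2 * p) / 2
           - (p - 1 / 2) * (exp (real n + 1) * fact (m - 1)
               * measure_pmf.prob (poisson_pmf (real n + 1)) {z. z \<le> m - 1}
               / (real n + 1) ^ (m - 1))
       \<and> measure_pmf.expectation (cond_pmf (parking_pmf p m n) all_parked)
           (\<lambda>(\<alpha>, _). real (\<alpha> ! (m - 1)))
         = (real n + 2 * p) / 2
           - (p - 1 / 2) * (exp (real n + 1) * upper_Gamma (real m) (real n + 1)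
               / (real n + 1) ^ (m - 1))"
proof -
  define M where "M = m - 1"
  have m: "m = Suc M" "M < n" using assms(1,2) by (auto simp: M_def)
  have "measure_pmf.expectation (cond_pmf (parking_pmf p m n) all_parked)
      (\<lambda>(\<alpha>, _). real (\<alpha> ! (m - 1)))
    = (real n + 2 * p) / 2 - (p - 1 / 2) * (poisson_sum M (real n + 1) / (real n + 1) ^ M)"
    using expected_last_preference[OF assms(3,4) m(2)] by (simp add: m(1))
  moreover have "poisson_sum M (real n + 1)
      = exp (real n + 1) * fact M * measure_pmf.prob (poisson_pmf (real n + 1)) {z. z \<le> M}"
    by (rule poisson_sum_eq_prob) simp
  moreover have "upper_Gamma (real m) (real n + 1)
      = fact M * measure_pmf.prob (poisson_pmf (real n + 1)) {z. z \<le> M}"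
    using upper_Gamma_eq_prob[of "real n + 1" M] by (simp add: m(1) add.commute)
  ultimately show ?thesis by (simp add: m(1) mult.assoc)
qed

end
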